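(* Let $G$ be a graph with $n$ vertices and let $X$ be the array, indexed by subsets of $V(G)$, computed by the following procedure. Initialization: for each $S\subseteq V(G)$, set $X[S]=\chi(S)$ if $\chi(S)\le 3$ and $X[S]=\infty$ otherwise. Main loop: visit the subsets $S$ of $V(G)$ in increasing order of the integer $\sum_{v_i\in S}2^i$ (where $V(G)=\{v_0,\dots,v_{n-1}\}$); when $S$ is visited and $3\le X[S]<\infty$, then for each independent set $I$ of $G\setminus S$ produced by a procedure that lists (at least) all maximal independent sets $I$ of $G\setminus S$ with $|I|\le |S|/X[S]$ (and possibly some other, non-maximal, independent sets of $G\setminus S$), set $X[S\cup I]=\min(X[S\cup I],X[S]+1)$. Then, given this array $X$, an optimal (i.e. using exactly $\chi(G)$ colors) proper coloring of $G$ can be computed in additional time $O(2^n)$ and no additional space.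
   Context: For $S\subseteq V(G)$, $\chi(S)$ is the chromatic number of the subgraph of $G$ induced by $S$; a proper coloring assigns colors to vertices so that adjacent vertices receive different colors. An independent set is a set of pairwise nonadjacent vertices; it is maximal in $G\setminus S$ if it is not properly contained in another independent subset of $V(G)\setminus S$. The model of computation is the unit-cost RAM: a single memory cell can hold an integer large enough to index the program's memory (in particular $n$-bit integers), and arithmetic and array-indexing operations on such values take constant time. *)

theory Defs
  imports
    "Graph_Theory.Graph_Theory"
    "HOL-Library.Extended_Nat"
    "HOL-Library.Nat_Bijection"
    "HOL-Library.Landau_Symbols"
begin

section \<open>Colorings and independent sets\<close>

definition proper_coloring :: "('a, 'b) pre_digraph \<Rightarrow> ('a \<Rightarrow> nat) \<Rightarrow> bool" where
  "proper_coloring H f \<longleftrightarrow> (\<forall>u v. u \<rightarrow>\<^bsub>H\<^esub> v \<longrightarrow> f u \<noteq> f v)"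

definition chromatic_number :: "('a, 'b) pre_digraph \<Rightarrow> nat" where
  "chromatic_number H = (LEAST k. \<exists>f. proper_coloring H f \<and> card (f ` verts H) = k)"

definition independent_set :: "('a, 'b) pre_digraph \<Rightarrow> 'a set \<Rightarrow> bool" where
  "independent_set H I \<longleftrightarrow> I \<subseteq> verts H \<and> (\<forall>u\<in>I. \<forall>v\<in>I. \<not> u \<rightarrow>\<^bsub>H\<^esub> v)"

definition maximal_independent_set :: "('a, 'b) pre_digraph \<Rightarrow> 'a set \<Rightarrow> bool" where
  "maximal_independent_set H I \<longleftrightarrow>
     independent_set H I \<and> \<not> (\<exists>J. independent_set H J \<and> I \<subset> J)"


section \<open>The array\<close>

text \<open>
  A graph is a symmetric loop-free digraph without parallel arcs (locale \<^locale>\<open>pair_graph\<close>).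
  Its vertex set is \<open>{..<n}\<close>, the vertex \<open>v\<^sub>i\<close> being the number \<open>i\<close>. The integer that orders the
  subsets \<open>S\<close> is then \<open>set_encode S\<close>, and \<open>set_decode\<close> maps \<open>{..<2 ^ n}\<close> back to the subsets.

  \<open>L S k\<close> is the list of sets, in the order in which they are produced, that the listing
  procedure returns for the graph \<open>G \<setminus> S\<close> and the size bound \<open>|S| / k\<close>.
\<close>

definition valid_lister ::
    "nat pair_pre_digraph \<Rightarrow> (nat set \<Rightarrow> nat \<Rightarrow> nat set list) \<Rightarrow> bool" where
  "valid_lister G L \<longleftrightarrow> (\<forall>S k. S \<subseteq> pverts G \<longrightarrow> 3 \<le> k \<longrightarrow>
     (let H = with_proj G \<restriction> (pverts G - S) in
       (\<forall>I\<in>set (L S k). independent_set H I) \<and>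
       (\<forall>I. maximal_independent_set H I \<and> real (card I) \<le> real (card S) / real k
            \<longrightarrow> I \<in> set (L S k))))"

definition initial_array :: "nat pair_pre_digraph \<Rightarrow> nat set \<Rightarrow> enat" where
  "initial_array G S =
     (let c = chromatic_number (with_proj G \<restriction> S) in if c \<le> 3 then enat c else \<infinity>)"

definition update :: "nat set \<Rightarrow> nat set \<Rightarrow> (nat set \<Rightarrow> enat) \<Rightarrow> (nat set \<Rightarrow> enat)" where
  "update S I X = X(S \<union> I := min (X (S \<union> I)) (X S + 1))"

definition visit ::
    "(nat set \<Rightarrow> nat \<Rightarrow> nat set list) \<Rightarrow> nat set \<Rightarrow> (nat set \<Rightarrow> enat) \<Rightarrow> (nat set \<Rightarrow> enat)" where
  "visit L S X =
     (if 3 \<le> X S \<and> X S < \<infinity> then fold (update S) (L S (the_enat (X S))) X else X)"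

definition computed_array ::
    "nat pair_pre_digraph \<Rightarrow> nat \<Rightarrow> (nat set \<Rightarrow> nat \<Rightarrow> nat set list) \<Rightarrow> nat set \<Rightarrow> enat" where
  "computed_array G n L = fold (visit L) (map set_decode [0..<2 ^ n]) (initial_array G)"


section \<open>The unit-cost RAM\<close>

text \<open>
  A program is a fixed list of instructions; it uses the finitely many registers that occur in
  its text, and a memory whose size never changes. Registers and memory cells hold natural
  numbers below the word limit \<open>W\<close>. Each instruction takes one step. Producing a number
  \<open>\<ge> W\<close>, addressing a cell outside the memory, or jumping outside the program is a fault: the
  machine has no next configuration, and it has not halted. Subtraction is truncated.
\<close>

datatype arith_op = Add | Sub | Mul | Div | Mod

fun apply_op :: "arith_op \<Rightarrow> nat \<Rightarrow> nat \<Rightarrow> nat" where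
  "apply_op Add x y = x + y"
| "apply_op Sub x y = x - y"
| "apply_op Mul x y = x * y"
| "apply_op Div x y = x div y"
| "apply_op Mod x y = x mod y"

datatype instr =
    LoadConst nat nat           \<comment> \<open>\<open>r\<^sub>d := k\<close>\<close>
  | Arith arith_op nat nat nat  \<comment> \<open>\<open>r\<^sub>d := r\<^sub>a \<circ> r\<^sub>b\<close>\<close>
  | Load nat nat                \<comment> \<open>\<open>r\<^sub>d := mem[r\<^sub>a]\<close>\<close>
  | Store nat nat               \<comment> \<open>\<open>mem[r\<^sub>a] := r\<^sub>b\<close>\<close>
  | JumpLess nat nat nat        \<comment> \<open>if \<open>r\<^sub>a < r\<^sub>b\<close> goto \<open>l\<close>\<close>
  | JumpEq nat nat nat          \<comment> \<open>if \<open>r\<^sub>a = r\<^sub>b\<close> goto \<open>l\<close>\<close>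
  | Halt

text \<open>Program counter, registers, memory.\<close>

type_synonym config = "nat \<times> (nat \<Rightarrow> nat) \<times> nat list"

definition write_reg :: "nat \<Rightarrow> nat \<Rightarrow> nat \<Rightarrow> config \<Rightarrow> config option" where
  "write_reg W d x = (\<lambda>(pc, R, M). if x < W then Some (Suc pc, R(d := x), M) else None)"

fun exec :: "nat \<Rightarrow> instr \<Rightarrow> config \<Rightarrow> config option" where
  "exec W (LoadConst d k) (pc, R, M) = write_reg W d k (pc, R, M)"
| "exec W (Arith f d a b) (pc, R, M) = write_reg W d (apply_op f (R a) (R b)) (pc, R, M)"
| "exec W (Load d a) (pc, R, M) =
     (if R a < length M then write_reg W d (M ! R a) (pc, R, M) else None)"
| "exec W (Store a b) (pc, R, M) =
     (if R a < length M then Some (Suc pc, R, M[R a := R b]) else None)"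
| "exec W (JumpLess a b l) (pc, R, M) = Some (if R a < R b then l else Suc pc, R, M)"
| "exec W (JumpEq a b l) (pc, R, M) = Some (if R a = R b then l else Suc pc, R, M)"
| "exec W Halt (pc, R, M) = None"

definition step :: "nat \<Rightarrow> instr list \<Rightarrow> config \<Rightarrow> config option" where
  "step W P C = (if fst C < length P then exec W (P ! fst C) C else None)"

definition halts_in :: "nat \<Rightarrow> instr list \<Rightarrow> config \<Rightarrow> nat \<Rightarrow> config \<Rightarrow> bool" where
  "halts_in W P C t C' \<longleftrightarrow>
     ((\<lambda>c c'. step W P c = Some c') ^^ t) C C' \<and> fst C' < length P \<and> P ! fst C' = Halt"


section \<open>Input and output\<close>

text \<open>
  The memory consists of the array (the entry of \<open>S\<close> in cell \<open>set_encode S\<close>), \<open>n\<close> cells for the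
  resulting coloring, and the adjacency matrix of the graph, in this order; there are no
  other cells. Register 0 initially holds \<open>n\<close> and the other registers hold 0.
\<close>

definition encode_entry :: "enat \<Rightarrow> nat" where
  "encode_entry x = (case x of enat k \<Rightarrow> Suc k | \<infinity> \<Rightarrow> 0)"

definition input_memory :: "nat pair_pre_digraph \<Rightarrow> nat \<Rightarrow> (nat set \<Rightarrow> enat) \<Rightarrow> nat list" where
  "input_memory G n X =
     map (\<lambda>s. encode_entry (X (set_decode s))) [0..<2 ^ n] @
     replicate n 0 @
     [of_bool ((i, j) \<in> parcs G). i \<leftarrow> [0..<n], j \<leftarrow> [0..<n]]"

definition input_config :: "nat pair_pre_digraph \<Rightarrow> nat \<Rightarrow> (nat set \<Rightarrow> enat) \<Rightarrow> config" where
  "input_config G n X = (0, (\<lambda>_. 0)(0 := n), input_memory G n X)"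

definition output_coloring :: "nat \<Rightarrow> config \<Rightarrow> nat \<Rightarrow> nat" where
  "output_coloring n C i = (case C of (_, _, M) \<Rightarrow> M ! (2 ^ n + i))"

definition optimal_coloring :: "('a, 'b) pre_digraph \<Rightarrow> ('a \<Rightarrow> nat) \<Rightarrow> bool" where
  "optimal_coloring H f \<longleftrightarrow>
     proper_coloring H f \<and> card (f ` verts H) = chromatic_number H"

end

theory Submission
  imports Defs
begin

text \<open>
  An entry \<open>X[S] = k > 0\<close> is either the initial \<open>\<chi>(S)\<close> or was written as \<open>X[T] + 1\<close> with
  \<open>S = T \<union> I\<close> for an independent set \<open>I\<close>. In both cases some \<open>T \<subset> S\<close> has \<open>X[T] = k - 1\<close> and
  \<open>X[S - T] = 1\<close>, so walking down from \<open>V(G)\<close> along such sets splits \<open>V(G)\<close> into \<open>X[V(G)]\<close> color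
  classes. Moreover \<open>X[M] \<le> k\<close> for every maximal \<open>k\<close>-colorable \<open>M\<close>, in particular for \<open>V(G)\<close>
  with \<open>k = \<chi>(G) \<ge> 3\<close>: remove a smallest color class from \<open>M\<close> and extend the rest to a maximal
  \<open>(k - 1)\<close>-colorable \<open>S \<subseteq> M\<close>; then \<open>M - S\<close> is a maximal independent set of \<open>G \<setminus> S\<close> of size at most
  \<open>|S| / (k - 1)\<close>, hence is listed when \<open>S\<close> is visited.

  The walk tries the subsets \<open>T\<close> of the current \<open>S\<close> by decreasing code: if \<open>p\<close> is the lowest bit of
  \<open>T\<close>, the next subset is \<open>T - p + S mod p\<close>. The codes of the candidates decrease during the
  whole run, and handling \<open>T\<close> costs \<open>O(1 + log p)\<close>, which adds up to \<open>O(2\<^sup>n)\<close>.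
\<close>

section \<open>Binary codes of sets\<close>

lemma set_encode_psubset:
  assumes "finite B" "A \<subset> B"
  shows "set_encode A < set_encode B"
proof -
  have "finite A" using assms finite_subset by blast
  then have "set_encode A \<le> set_encode B" "set_encode A \<noteq> set_encode B"
    using assms subset_decode_imp_le[of "set_encode A" "set_encode B"] by (auto simp: set_encode_eq)
  then show ?thesis by simp
qed

lemma set_encode_lessThan: "set_encode {..<n} = 2 ^ n - 1"
  by (simp add: set_encode_def atLeast0LessThan[symmetric] sum_power2)

lemma set_encode_less_power_iff:
  assumes "finite A"
  shows "set_encode A < 2 ^ n \<longleftrightarrow> A \<subseteq> {..<n}"
proof
  assume "A \<subseteq> {..<n}"
  then have "set_encode A \<le> set_encode {..<n}"
    by (intro subset_decode_imp_le) (simp add: assms)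
  then show "set_encode A < 2 ^ n"
    by (simp add: set_encode_lessThan Nat.le_diff_conv2)
next
  assume less: "set_encode A < 2 ^ n"
  show "A \<subseteq> {..<n}"
  proof
    fix v assume "v \<in> A"
    then have "set_decode (set_encode {v}) \<subseteq> set_decode (set_encode A)"
      using assms by (subst set_encode_inverse) auto
    then have "set_encode {v} \<le> set_encode A"
      by (rule subset_decode_imp_le)
    from le_less_trans[OF this less] have "(2::nat) ^ v < 2 ^ n" by simp
    then show "v \<in> {..<n}" by simp
  qed
qed

text \<open>Lets the program form \<open>S - T\<close> for nested sets by one subtraction of
  codes.\<close>

lemma set_encode_Diff:
  assumes "finite B" "A \<subseteq> B"
  shows "set_encode (B - A) = set_encode B - set_encode A"
  using assms by (simp add: set_encode_def sum_diff_nat finite_subset)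

lemma power_dvd_set_encode: "A \<subseteq> {v..} \<Longrightarrow> 2 ^ v dvd set_encode A"
  unfolding set_encode_def by (intro dvd_sum) (auto intro: le_imp_power_dvd)

lemma set_encode_split:
  assumes "finite A"
  shows "set_encode A = set_encode (A \<inter> {..<v}) + set_encode (A \<inter> {v..})"
proof -
  have "A = A \<inter> {..<v} \<union> A \<inter> {v..}" by auto
  then show ?thesis
    using assms unfolding set_encode_def by (subst (1) \<open>A = _\<close>, intro sum.union_disjoint) auto
qed

lemma set_encode_Int_lessThan_less: "set_encode (A \<inter> {..<v}) < 2 ^ v"
  by (simp add: set_encode_less_power_iff)

text \<open>The instruction set has no bitwise operations; cutting a set down to its elements below
  \<open>v\<close> becomes a remainder.\<close>

lemma set_encode_mod_power:
  assumes "finite A"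
  shows "set_encode A mod 2 ^ v = set_encode (A \<inter> {..<v})"
proof -
  obtain q where "set_encode (A \<inter> {v..}) = 2 ^ v * q"
    using power_dvd_set_encode[of "A \<inter> {v..}" v] by auto
  then show ?thesis
    using set_encode_split[OF assms, of v] set_encode_Int_lessThan_less[of A v] by simp
qed

text \<open>The predecessor of \<open>A\<close> among the subsets of \<open>B\<close> in code order,
  known as \<open>(A - 1) AND B\<close> on bit masks. This form can be computed by arithmetic once
  \<open>2 ^ Min A\<close> is known.\<close>

definition next_subset :: "nat set \<Rightarrow> nat set \<Rightarrow> nat set" where
  "next_subset B A = A - {Min A} \<union> B \<inter> {..<Min A}"

text \<open>No subset of \<open>B\<close> is skipped: split \<open>C\<close> at
  \<open>Min A\<close>. Its upper part is a multiple of \<open>2 ^ Min A\<close> below the code of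
  \<open>A\<close>, and its lower part lies in \<open>B \<inter> {..<Min A}\<close>, all of which
  \<open>next_subset\<close> includes.\<close>

lemma
  assumes "finite B" "A \<subseteq> B" "A \<noteq> {}"
  shows next_subset_subset: "next_subset B A \<subseteq> B"
    and set_encode_next_subset:
      "set_encode (next_subset B A) = set_encode A - 2 ^ Min A + set_encode B mod 2 ^ Min A"
    and set_encode_next_subset_less: "set_encode (next_subset B A) < set_encode A"
    and set_encode_le_next_subset:
      "C \<subseteq> B \<Longrightarrow> set_encode C < set_encode A \<Longrightarrow> set_encode C \<le> set_encode (next_subset B A)"
proof -
  let ?v = "Min A"
  have fin: "finite A" using assms finite_subset by blast
  have v: "?v \<in> A" "\<And>w. w \<in> A \<Longrightarrow> ?v \<le> w"
    using fin assms(3) by auto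
  show "next_subset B A \<subseteq> B"
    using assms(2) by (auto simp: next_subset_def)
  have "set_encode (insert ?v (A - {?v})) = 2 ^ ?v + set_encode (A - {?v})"
    using fin by (intro set_encode_insert) auto
  then have remove: "set_encode A = 2 ^ ?v + set_encode (A - {?v})"
    using v(1) by (simp add: insert_absorb)
  have "set_encode (next_subset B A) = set_encode (A - {?v}) + set_encode (B \<inter> {..<?v})"
    unfolding next_subset_def set_encode_def
    using fin assms(1) by (intro sum.union_disjoint) (auto dest!: v(2))
  then show eq: "set_encode (next_subset B A) = set_encode A - 2 ^ ?v + set_encode B mod 2 ^ ?v"
    using remove by (simp add: set_encode_mod_power[OF assms(1)])
  then show "set_encode (next_subset B A) < set_encode A"
    using remove by (simp add: add.commute)
  assume C: "C \<subseteq> B" "set_encode C < set_encode A"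
  have finC: "finite C" using C assms(1) finite_subset by blast
  obtain q where q: "set_encode (C \<inter> {?v..}) = 2 ^ ?v * q"
    using power_dvd_set_encode[of "C \<inter> {?v..}" ?v] by auto
  obtain r where r: "set_encode A = 2 ^ ?v * r"
    using power_dvd_set_encode[of A ?v] v(2) by auto
  \<comment> \<open>Two multiples of \<open>2 ^ Min A\<close> that differ do so by at least
    \<open>2 ^ Min A\<close>.\<close>
  have "2 ^ ?v * q < 2 ^ ?v * r"
    using C(2) set_encode_split[OF finC, of ?v] q r by linarith
  then have "2 ^ ?v * Suc q \<le> 2 ^ ?v * r"
    by (intro mult_le_mono2) simp
  then have "set_encode (C \<inter> {?v..}) \<le> set_encode A - 2 ^ ?v"
    using q r by simp
  moreover have "set_encode (C \<inter> {..<?v}) \<le> set_encode (B \<inter> {..<?v})"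
    using C(1) finC assms(1) by (intro subset_decode_imp_le) auto
  ultimately show "set_encode C \<le> set_encode (next_subset B A)"
    using set_encode_split[OF finC, of ?v] by (simp add: eq set_encode_mod_power[OF assms(1)])
qed

lemma odd_set_encode_div: "finite A \<Longrightarrow> odd (set_encode A div 2 ^ v) \<longleftrightarrow> v \<in> A"
  using set_encode_inverse[of A] by (auto simp: set_decode_def)

text \<open>\<open>halves m\<close> is the sum, over \<open>1 \<le> t \<le> m\<close>, of 1 plus the 2-adic valuation of \<open>t\<close>.\<close>

fun halves :: "nat \<Rightarrow> nat" where
  "halves m = (if m = 0 then 0 else m + halves (m div 2))"

declare halves.simps [simp del]

text \<open>Geometric series. This is what turns the running time, measured in
  \<open>halves\<close>, into \<open>O(2^n)\<close>.\<close>

lemma halves_le: "halves m \<le> 2 * m"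
proof (induction m rule: less_induct)
  case (less m)
  show ?case
  proof (cases "m = 0")
    case False
    then have "halves (m div 2) \<le> 2 * (m div 2)"
      by (intro less.IH) simp
    also have "\<dots> \<le> m" by simp
    finally show ?thesis by (subst halves.simps) simp
  qed (simp add: halves.simps)
qed

lemma halves_add_le:
  assumes "l \<le> m"
  shows "halves l + (m - l) \<le> halves m"
  using assms
proof (induction m arbitrary: l rule: less_induct)
  case (less m)
  show ?case
  proof (cases "m = 0")
    case False
    then have "halves (l div 2) + (m div 2 - l div 2) \<le> halves (m div 2)"
      using less by (intro less.IH) (auto simp: div_le_mono)
    then show ?thesis
      using less.prems False by (subst (1 2) halves.simps) auto
  qed (use less in auto)
qed

text \<open>Amortization: a candidate whose lowest bit is at position \<open>v\<close> releases more
  than \<open>v\<close> units, which pays for the linear search for that bit. In the induction,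
  halving \<open>2 * l\<close> and \<open>2 * l - 1\<close> gives \<open>l\<close> and
  \<open>l - 1\<close>.\<close>

lemma halves_pred:
  assumes "2 ^ v dvd m" "m \<noteq> 0"
  shows "halves (m - 1) + v < halves m"
  using assms
proof (induction v arbitrary: m)
  case 0
  then show ?case using halves_add_le[of "m - 1" m] by simp
next
  case (Suc v)
  then obtain l where l: "m = 2 * l" "2 ^ v dvd l" "l \<noteq> 0"
    by (auto simp: dvd_def mult.assoc)
  have "halves (2 * l) = 2 * l + halves l"
    using l(3) by (subst halves.simps) simp
  moreover have "halves (2 * l - 1) = 2 * l - 1 + halves (l - 1)"
  proof -
    have "(2 * l - 1) div 2 = l - 1" "2 * l - 1 \<noteq> 0" using l(3) by auto
    then show ?thesis by (subst halves.simps) simp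
  qed
  ultimately show ?case
    using Suc.IH[OF l(2,3)] l(1,3) by simp
qed


section \<open>Colorability of induced subgraphs\<close>

lemma dominates_induce_subgraph_iff:
  "u \<rightarrow>\<^bsub>with_proj G \<restriction> S\<^esub> v \<longleftrightarrow> (u, v) \<in> parcs G \<and> u \<in> S \<and> v \<in> S"
  by (force simp: arcs_ends_conv)

text \<open>Passes from the least exact number of used colors to a palette \<open>{..<k}\<close>. An
  injective coloring shows that the \<open>LEAST\<close> is attained, and a bijection onto an
  initial segment renames the colors.\<close>

lemma chromatic_number_le_iff:
  fixes H :: "('a, 'b) pre_digraph"
  assumes fin: "finite (verts H)" and loopfree: "\<And>u. \<not> u \<rightarrow>\<^bsub>H\<^esub> u"
    and wf: "\<And>u v. u \<rightarrow>\<^bsub>H\<^esub> v \<Longrightarrow> u \<in> verts H \<and> v \<in> verts H"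
  shows "chromatic_number H \<le> k \<longleftrightarrow> (\<exists>f. f ` verts H \<subseteq> {..<k} \<and> proper_coloring H f)"
proof
  assume le: "chromatic_number H \<le> k"
  obtain g where "inj_on g (verts H)" and "range g \<subseteq> (UNIV :: nat set)"
    using finite_imp_inj_to_nat_seg[OF fin] by blast
  then have "proper_coloring H g"
    unfolding proper_coloring_def using loopfree wf by (metis inj_onD)
  then have "\<exists>f. proper_coloring H f \<and> card (f ` verts H) = chromatic_number H"
    unfolding chromatic_number_def
    using LeastI_ex[of "\<lambda>k. \<exists>f. proper_coloring H f \<and> card (f ` verts H) = k"] by blast
  then obtain f where f: "proper_coloring H f" "card (f ` verts H) = chromatic_number H"
    by blast
  obtain h where h: "bij_betw h (f ` verts H) {0..<card (f ` verts H)}"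
    using ex_bij_betw_finite_nat[of "f ` verts H"] fin by blast
  have "proper_coloring H (h \<circ> f)"
    unfolding proper_coloring_def
  proof (intro allI impI)
    fix u v assume uv: "u \<rightarrow>\<^bsub>H\<^esub> v"
    then have "f u \<noteq> f v" "f u \<in> f ` verts H" "f v \<in> f ` verts H"
      using f(1) wf[OF uv] by (auto simp: proper_coloring_def)
    then show "(h \<circ> f) u \<noteq> (h \<circ> f) v"
      using h by (auto simp: bij_betw_def dest: inj_onD)
  qed
  moreover have "(h \<circ> f) ` verts H \<subseteq> {..<k}"
  proof -
    have "(h \<circ> f) ` verts H = {0..<chromatic_number H}"
      using h f(2) by (metis bij_betw_imp_surj_on image_comp)
    then show ?thesis using le by auto
  qed
  ultimately show "\<exists>f. f ` verts H \<subseteq> {..<k} \<and> proper_coloring H f" by blast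
next
  assume "\<exists>f. f ` verts H \<subseteq> {..<k} \<and> proper_coloring H f"
  then obtain f where f: "f ` verts H \<subseteq> {..<k}" "proper_coloring H f" by blast
  have "chromatic_number H \<le> card (f ` verts H)"
    unfolding chromatic_number_def by (rule Least_le) (use f in blast)
  also have "\<dots> \<le> k"
    using card_mono[OF _ f(1)] by simp
  finally show "chromatic_number H \<le> k" .
qed

section \<open>Colorability with at most k colors, and removal of color classes\<close>

definition colorable :: "'a pair_pre_digraph \<Rightarrow> 'a set \<Rightarrow> nat \<Rightarrow> bool" where
  "colorable G S k \<longleftrightarrow>
     (\<exists>f. f ` S \<subseteq> {..<k} \<and> (\<forall>u\<in>S. \<forall>v\<in>S. (u, v) \<in> parcs G \<longrightarrow> f u \<noteq> f v))"

definition stable :: "'a pair_pre_digraph \<Rightarrow> 'a set \<Rightarrow> bool" where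
  "stable G I \<longleftrightarrow> (\<forall>u\<in>I. \<forall>v\<in>I. (u, v) \<notin> parcs G)"

lemma colorable_mono: "colorable G S k \<Longrightarrow> T \<subseteq> S \<Longrightarrow> k \<le> l \<Longrightarrow> colorable G T l"
  unfolding colorable_def by (meson image_mono lessThan_subset_iff order_trans subsetD)

lemma colorable_0_iff: "colorable G S 0 \<longleftrightarrow> S = {}"
  by (auto simp: colorable_def)

lemma colorable_1_iff: "colorable G S (Suc 0) \<longleftrightarrow> stable G S"
proof
  assume "colorable G S (Suc 0)"
  then show "stable G S" by (auto simp: colorable_def stable_def image_subset_iff)
next
  assume "stable G S"
  then show "colorable G S (Suc 0)"
    unfolding colorable_def stable_def by (intro exI[of _ "\<lambda>_. 0"]) auto
qed

lemma stable_subset: "stable G I \<Longrightarrow> J \<subseteq> I \<Longrightarrow> stable G J"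
  by (auto simp: stable_def)

text \<open>All of \<open>I\<close>, including its overlap with \<open>S\<close>, receives the fresh
  color \<open>k\<close>.\<close>

lemma colorable_Un_stable:
  assumes "colorable G S k" "stable G I"
  shows "colorable G (S \<union> I) (Suc k)"
proof -
  obtain f where f: "f ` S \<subseteq> {..<k}" "\<forall>u\<in>S. \<forall>v\<in>S. (u, v) \<in> parcs G \<longrightarrow> f u \<noteq> f v"
    using assms(1) by (auto simp: colorable_def)
  show ?thesis
    unfolding colorable_def
  proof (intro exI[of _ "\<lambda>v. if v \<in> I then k else f v"] conjI ballI impI)
    show "(\<lambda>v. if v \<in> I then k else f v) ` (S \<union> I) \<subseteq> {..<Suc k}"
      using f(1) by (auto simp: image_subset_iff less_Suc_eq)
  next
    fix u v assume uv: "u \<in> S \<union> I" "v \<in> S \<union> I" "(u, v) \<in> parcs G"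
    have "f w < k" if "w \<in> S" for w
      using f(1) that by blast
    moreover have "\<not> (u \<in> I \<and> v \<in> I)"
      using assms(2) uv(3) by (auto simp: stable_def)
    ultimately show "(if u \<in> I then k else f u) \<noteq> (if v \<in> I then k else f v)"
      using f(2)[rule_format, of u v] uv by (metis UnE less_irrefl)
  qed
qed

lemma colorable_remove_class:
  assumes "colorable G S (Suc k)"
  obtains I where "I \<subseteq> S" "stable G I" "colorable G (S - I) k"
proof -
  obtain f where f: "f ` S \<subseteq> {..<Suc k}" "\<forall>u\<in>S. \<forall>v\<in>S. (u, v) \<in> parcs G \<longrightarrow> f u \<noteq> f v"
    using assms by (auto simp: colorable_def)
  let ?I = "{v \<in> S. f v = k}"
  have "colorable G (S - ?I) k"
    unfolding colorable_def
  proof (intro exI[of _ f] conjI)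
    show "f ` (S - ?I) \<subseteq> {..<k}"
      using f(1) by (auto simp: less_Suc_eq)
  qed (use f(2) in blast)
  moreover have "stable G ?I"
    unfolding stable_def using f(2) by (metis (mono_tags, lifting) mem_Collect_eq)
  ultimately show ?thesis
    using that[of ?I] by auto
qed

text \<open>Pigeonhole: if each of the \<open>Suc k\<close> classes exceeded the average size, their
  sizes would sum to more than \<open>card S\<close>.\<close>

lemma colorable_remove_small_class:
  assumes "colorable G S (Suc k)" "finite S"
  obtains I where "I \<subseteq> S" "stable G I" "colorable G (S - I) k" "Suc k * card I \<le> card S"
proof -
  obtain f where f: "f ` S \<subseteq> {..<Suc k}" "\<forall>u\<in>S. \<forall>v\<in>S. (u, v) \<in> parcs G \<longrightarrow> f u \<noteq> f v"
    using assms by (auto simp: colorable_def)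
  define I where "I c = {v \<in> S. f v = c}" for c
  have "S = (\<Union>c<Suc k. I c)"
    using f(1) by (force simp: I_def image_subset_iff)
  moreover have "card (\<Union>c<Suc k. I c) = (\<Sum>c<Suc k. card (I c))"
    using assms(2) by (intro card_UN_disjoint) (auto simp: I_def)
  ultimately have sum: "card S = (\<Sum>c<Suc k. card (I c))"
    by simp
  have "\<exists>c<Suc k. Suc k * card (I c) \<le> card S"
  proof (rule ccontr)
    assume "\<not> ?thesis"
    then have "\<And>c. c < Suc k \<Longrightarrow> card S < Suc k * card (I c)"
      by (meson not_le)
    then have "(\<Sum>c<Suc k. card S) < (\<Sum>c<Suc k. Suc k * card (I c))"
      by (intro sum_strict_mono) auto
    then show False
      by (simp add: sum sum_distrib_left[symmetric] del: sum.lessThan_Suc mult_Suc)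
  qed
  then obtain c where c: "c < Suc k" "Suc k * card (I c) \<le> card S" by blast
  \<comment> \<open>The freed color \<open>c\<close> is given to the class of color
    \<open>k\<close>, so that the palette becomes \<open>{..<k}\<close>.\<close>
  let ?g = "\<lambda>v. if f v = k then c else f v"
  have "colorable G (S - I c) k"
    unfolding colorable_def
  proof (intro exI[of _ ?g] conjI ballI impI)
    show "?g ` (S - I c) \<subseteq> {..<k}"
      using f(1) c(1) by (auto simp: I_def less_Suc_eq)
  next
    fix u v assume "u \<in> S - I c" "v \<in> S - I c" "(u, v) \<in> parcs G"
    then show "?g u \<noteq> ?g v"
      using f(2)[rule_format, of u v] by (auto simp: I_def)
  qed
  moreover have "stable G (I c)"
    unfolding stable_def I_def using f(2) by (metis (mono_tags, lifting) mem_Collect_eq)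
  ultimately show ?thesis
    using that[of "I c"] c(2) by (auto simp: I_def)
qed

section \<open>Chromatic numbers of the induced subgraphs of a fixed graph\<close>

context pair_graph
begin

abbreviation chi :: "'a set \<Rightarrow> nat" where
  "chi S \<equiv> chromatic_number (with_proj G \<restriction> S)"

lemma chi_le_iff:
  assumes "S \<subseteq> pverts G"
  shows "chi S \<le> k \<longleftrightarrow> colorable G S k"
proof -
  let ?H = "with_proj G \<restriction> S"
  have "chi S \<le> k \<longleftrightarrow> (\<exists>f. f ` verts ?H \<subseteq> {..<k} \<and> proper_coloring ?H f)"
  proof (rule chromatic_number_le_iff)
    show "finite (verts ?H)"
      using finite_subset[OF assms pair_finite_verts] by simp
    show "\<not> u \<rightarrow>\<^bsub>?H\<^esub> u" for u
      using pair_no_loops[of "(u, u)"] by (auto simp: dominates_induce_subgraph_iff)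
    show "u \<rightarrow>\<^bsub>?H\<^esub> v \<Longrightarrow> u \<in> verts ?H \<and> v \<in> verts ?H" for u v
      by (auto simp: dominates_induce_subgraph_iff)
  qed
  also have "\<dots> \<longleftrightarrow> colorable G S k"
    unfolding proper_coloring_def colorable_def dominates_induce_subgraph_iff induce_subgraph_verts by blast
  finally show ?thesis .
qed

lemma chromatic_number_eq_chi: "chromatic_number (with_proj G) = chi (pverts G)"
proof -
  have "u \<rightarrow>\<^bsub>with_proj G \<restriction> pverts G\<^esub> v \<longleftrightarrow> u \<rightarrow>\<^bsub>with_proj G\<^esub> v" for u v
    using in_arcsD1 in_arcsD2 by (auto simp: dominates_induce_subgraph_iff)
  then show ?thesis
    by (simp add: chromatic_number_def proper_coloring_def)
qed

lemma chromatic_number_le_card_colors: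
  assumes "proper_coloring (with_proj G) f"
  shows "chromatic_number (with_proj G) \<le> card (f ` pverts G)"
  unfolding chromatic_number_def by (rule Least_le) (use assms in auto)

lemma independent_set_iff:
  "independent_set (with_proj G \<restriction> S) I \<longleftrightarrow> I \<subseteq> S \<and> stable G I"
  by (auto simp: independent_set_def stable_def dominates_induce_subgraph_iff)

end


section \<open>The computed array\<close>

text \<open>The facts about the finished array from which all else follows. Both sides of an update
  are expressed by final entries, so the order of the visits does not appear any more.\<close>

locale coloring_array = pair_graph G for G :: "nat pair_pre_digraph" +
  fixes L :: "nat set \<Rightarrow> nat \<Rightarrow> nat set list" and X :: "nat set \<Rightarrow> enat"
  assumes lister: "valid_lister G L"
    and le_initial: "S \<subseteq> pverts G \<Longrightarrow> X S \<le> initial_array G S"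
    and le_Suc: "S \<subseteq> pverts G \<Longrightarrow> X S = enat k \<Longrightarrow> 3 \<le> k \<Longrightarrow> I \<in> set (L S k) \<Longrightarrow>
      X (S \<union> I) \<le> enat (Suc k)"
    and origin: "S \<subseteq> pverts G \<Longrightarrow> X S = initial_array G S \<or>
      (\<exists>T I k. T \<subset> S \<and> S = T \<union> I \<and> X T = enat k \<and> 3 \<le> k \<and> I \<in> set (L T k) \<and>
        X S = enat (Suc k))"
begin

lemma stable_listed:
  assumes "S \<subseteq> pverts G" "3 \<le> k" "I \<in> set (L S k)"
  shows "I \<subseteq> pverts G - S" "stable G I"
proof -
  have "independent_set (with_proj G \<restriction> (pverts G - S)) I"
    using lister assms by (auto simp: valid_lister_def Let_def)
  then show "I \<subseteq> pverts G - S" "stable G I"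
    by (auto simp: independent_set_iff)
qed

lemma maximal_listed:
  assumes "S \<subseteq> pverts G" "3 \<le> k" "I \<subseteq> pverts G - S" "stable G I"
    and max: "\<And>J. J \<subseteq> pverts G - S \<Longrightarrow> stable G J \<Longrightarrow> \<not> I \<subset> J"
    and small: "k * card I \<le> card S"
  shows "I \<in> set (L S k)"
proof -
  have "real k * real (card I) \<le> real (card S)"
    using small by (metis of_nat_le_iff of_nat_mult)
  then have "real (card I) \<le> real (card S) / real k"
    using assms(2) by (simp add: field_simps)
  moreover have "maximal_independent_set (with_proj G \<restriction> (pverts G - S)) I"
    using assms by (auto simp: maximal_independent_set_def independent_set_iff)
  ultimately show ?thesis
    using lister assms by (auto simp: valid_lister_def Let_def)
qed

text \<open>Finite entries never fall below \<chi>: an update adds one stable set and raises the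
  entry by one, so the induction runs on the entry.\<close>

lemma colorable_entry:
  assumes "S \<subseteq> pverts G" "X S = enat k"
  shows "colorable G S k"
  using assms
proof (induction k arbitrary: S rule: less_induct)
  case (less k)
  from origin[OF less.prems(1)] show ?case
  proof (elim disjE exE conjE)
    assume "X S = initial_array G S"
    then have "chi S \<le> k"
      using less.prems by (auto simp: initial_array_def Let_def split: if_splits)
    then show ?thesis using chi_le_iff less.prems(1) by blast
  next
    fix T I l
    assume T: "T \<subset> S" "S = T \<union> I" "X T = enat l" "3 \<le> l" "I \<in> set (L T l)" "X S = enat (Suc l)"
    have TV: "T \<subseteq> pverts G" using T(1) less.prems(1) by blast
    have k: "k = Suc l" using T(6) less.prems(2) by simp
    have "colorable G T l"
      using less.IH[of l T] k TV T(3) by simp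
    then show ?thesis
      using colorable_Un_stable stable_listed(2)[OF TV T(4,5)] unfolding k T(2) by blast
  qed
qed

lemma entry_eq_chi:
  assumes "S \<subseteq> pverts G" "chi S \<le> 3"
  shows "X S = enat (chi S)"
proof -
  have "X S \<le> enat (chi S)"
    using le_initial[OF assms(1)] assms(2) by (simp add: initial_array_def)
  then obtain k where k: "X S = enat k" "k \<le> chi S"
    by (cases "X S") auto
  then show ?thesis
    using colorable_entry[OF assms(1) k(1)] chi_le_iff[OF assms(1), of k] by simp
qed

lemma entry_0_iff:
  assumes "S \<subseteq> pverts G"
  shows "X S = enat 0 \<longleftrightarrow> S = {}"
proof
  assume "X S = enat 0"
  then show "S = {}" using colorable_entry[OF assms] by (simp add: colorable_0_iff)
next
  assume "S = {}"
  then have "chi S = 0"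
    using chi_le_iff[OF assms, of 0] by (simp add: colorable_0_iff)
  then show "X S = enat 0" using entry_eq_chi[OF assms] by simp
qed

lemma entry_1_iff:
  assumes "S \<subseteq> pverts G"
  shows "X S = enat 1 \<longleftrightarrow> S \<noteq> {} \<and> stable G S"
proof
  assume X: "X S = enat 1"
  then have "X S \<noteq> enat 0" by simp
  then show "S \<noteq> {} \<and> stable G S"
    using colorable_entry[OF assms X] entry_0_iff[OF assms] by (simp add: colorable_1_iff)
next
  assume "S \<noteq> {} \<and> stable G S"
  then have "chi S \<le> 1" "\<not> chi S \<le> 0"
    unfolding chi_le_iff[OF assms] by (simp_all add: colorable_0_iff colorable_1_iff)
  then show "X S = enat 1" using entry_eq_chi[OF assms] by simp
qed

text \<open>Bounds the entries so that they fit into machine words. An update raises the entry by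
  one and strictly enlarges the set.\<close>

lemma entry_le_card:
  assumes "S \<subseteq> pverts G" "X S = enat k"
  shows "k \<le> card S"
  using assms
proof (induction k arbitrary: S rule: less_induct)
  case (less k)
  have fin: "finite S"
    using less.prems(1) pair_finite_verts finite_subset by blast
  from origin[OF less.prems(1)] show ?case
  proof (elim disjE exE conjE)
    assume "X S = initial_array G S"
    then have "chi S = k"
      using less.prems by (auto simp: initial_array_def Let_def split: if_splits)
    moreover have "colorable G S (card S)"
    proof -
      obtain f :: "nat \<Rightarrow> nat" where "bij_betw f S {0..<card S}"
        using ex_bij_betw_finite_nat[OF fin] by blast
      then show ?thesis
        unfolding colorable_def
        by (intro exI[of _ f]) (auto simp: bij_betw_def dest!: pair_no_loops inj_onD)
    qed
    ultimately show ?thesis using chi_le_iff less.prems(1) by blast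
  next
    fix T I l
    assume T: "T \<subset> S" "X T = enat l" "X S = enat (Suc l)"
    then have "l \<le> card T"
      using less.IH[of l T] less.prems by auto
    also have "card T < card S"
      using fin T(1) by (rule psubset_card_mono)
    finally show ?thesis using T less.prems by simp
  qed
qed

text \<open>If the entry is initial, removing a class of an optimal coloring leaves a set with
  \<chi> exactly \<open>k\<close>, where the array is exact because \<open>k\<close> is below 3. If
  it was written by an update, the set it came from serves as \<open>T\<close>.\<close>

lemma peel_class:
  assumes "S \<subseteq> pverts G" "X S = enat (Suc k)"
  obtains T where "T \<subset> S" "X T = enat k" "X (S - T) = enat 1"
proof -
  have "\<exists>T. T \<subset> S \<and> X T = enat k \<and> stable G (S - T)"
    using origin[OF assms(1)]
  proof (elim disjE exE conjE)
    assume "X S = initial_array G S"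
    then have chi: "chi S = Suc k" "Suc k \<le> 3"
      using assms by (auto simp: initial_array_def Let_def split: if_splits)
    then have "colorable G S (Suc k)"
      using chi_le_iff[OF assms(1), of "Suc k"] by simp
    then obtain I where I: "I \<subseteq> S" "stable G I" "colorable G (S - I) k"
      by (rule colorable_remove_class)
    let ?T = "S - I"
    have T: "?T \<subseteq> pverts G" using assms(1) by blast
    \<comment> \<open>Fewer than \<open>k\<close> colors on the rest, plus one for \<open>I\<close>,
      would contradict \<open>chi S = Suc k\<close>.\<close>
    have "\<not> colorable G ?T l" if "l < k" for l
      using colorable_Un_stable[OF _ I(2), of ?T l] that chi(1) I(1) chi_le_iff[OF assms(1), of "Suc l"]
      by (auto simp: Un_absorb2)
    then have "chi ?T = k"
      using I(3) chi_le_iff[OF T] by (metis le_neq_implies_less order_refl)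
    then have "X ?T = enat k"
      using entry_eq_chi[OF T] chi(2) by simp
    moreover have "S \<noteq> ?T"
      using chi(1) \<open>chi ?T = k\<close> by auto
    moreover have "S - ?T = I" using I(1) by blast
    ultimately show ?thesis
      using I(2) by (intro exI[of _ ?T]) auto
  next
    fix T I l
    assume T: "T \<subset> S" "S = T \<union> I" "X T = enat l" "3 \<le> l" "I \<in> set (L T l)" "X S = enat (Suc l)"
    have "stable G (S - T)"
      using stable_listed[of T l I] stable_subset[of G I "S - T"] T assms(1) by auto
    then show ?thesis
      using T assms(2) by (intro exI[of _ T]) auto
  qed
  then obtain T where "T \<subset> S" "X T = enat k" "stable G (S - T)" by blast
  then show ?thesis
    using that[of T] entry_1_iff[of "S - T"] assms(1) by auto
qed

text \<open>Maximality is what makes the last color class a maximal independent set of the remaining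
  graph, hence certain to be listed; the induction must therefore carry it down to the smaller set
  \<open>S\<close>.\<close>

lemma maximal_colorable_entry:
  assumes "3 \<le> k" "M \<subseteq> pverts G" "colorable G M k"
    and "\<And>M'. M \<subset> M' \<Longrightarrow> M' \<subseteq> pverts G \<Longrightarrow> \<not> colorable G M' k"
  shows "X M \<le> enat k"
  using assms
proof (induction k arbitrary: M rule: dec_induct)
  case base
  then show ?case
    using entry_eq_chi chi_le_iff by (metis enat_ord_simps(1))
next
  case (step k)
  note max = step.prems(3)
  have fin: "finite M"
    using step.prems(1) pair_finite_verts finite_subset by blast
  show ?case
  proof (cases "colorable G M k")
    case True
    \<comment> \<open>A \<open>k\<close>-colorable proper superset would also be
      \<open>Suc k\<close>-colorable, so \<open>M\<close> is maximal for \<open>k\<close> as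
      well.\<close>
    have "X M \<le> enat k"
    proof (rule step.IH[OF step.prems(1) True])
      show "\<not> colorable G M' k" if "M \<subset> M'" "M' \<subseteq> pverts G" for M'
        using max[OF that] colorable_mono[of G M' k M' "Suc k"] by auto
    qed
    then show ?thesis by (rule order_trans) simp
  next
    case False
    obtain I where I: "I \<subseteq> M" "stable G I" "colorable G (M - I) k" "Suc k * card I \<le> card M"
      using colorable_remove_small_class[OF step.prems(2) fin] .
    define F where "F = {S. M - I \<subseteq> S \<and> S \<subseteq> M \<and> colorable G S k}"
    have "finite F"
      by (rule finite_subset[of _ "Pow M"]) (use fin in \<open>auto simp: F_def\<close>)
    moreover have "M - I \<in> F"
      using I by (auto simp: F_def)
    ultimately obtain S where S: "S \<in> F" "\<And>S'. S' \<in> F \<Longrightarrow> S \<subseteq> S' \<Longrightarrow> S = S'"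
      by (meson finite_has_maximal2)
    have S_sub: "S \<subseteq> M" "M - I \<subseteq> S" "colorable G S k"
      using S(1) by (auto simp: F_def)
    have stab: "stable G (M - S)"
      using stable_subset[OF I(2)] S_sub(2) by blast
    have grow: "M \<subseteq> S' \<union> (M - S)" if "S \<subseteq> S'" for S'
      using that by blast
    \<comment> \<open>\<open>S\<close> was chosen maximal only inside \<open>M\<close>. A larger
      \<open>k\<close>-colorable \<open>S'\<close> elsewhere, joined with the stable
      \<open>M - S\<close>, would be \<open>Suc k\<close>-colorable and contain \<open>M\<close>; so
      it equals \<open>M\<close>, and \<open>S'\<close> lies inside \<open>M\<close> after
      all.\<close>
    have S_max: "\<not> colorable G S' k" if "S \<subset> S'" "S' \<subseteq> pverts G" for S'
    proof
      assume col: "colorable G S' k"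
      have "colorable G (S' \<union> (M - S)) (Suc k)"
        using colorable_Un_stable[OF col stab] .
      then have "M = S' \<union> (M - S)"
        using max[of "S' \<union> (M - S)"] grow[of S'] that step.prems(1) by blast
      then have "S' \<in> F" using col that S_sub by (auto simp: F_def)
      then show False using S(2) that by blast
    qed
    have SV: "S \<subseteq> pverts G"
      using S_sub(1) step.prems(1) by blast
    have "X S \<le> enat k"
      using step.IH[OF SV S_sub(3) S_max] .
    then obtain l where l: "X S = enat l" "l \<le> k"
      by (cases "X S") auto
    moreover have "colorable G S l"
      using colorable_entry[OF SV l(1)] .
    then have "colorable G M (Suc l)"
      using colorable_Un_stable[OF _ stab, of S l] S_sub(1) by (simp add: Un_absorb1)
    \<comment> \<open>The entry must be exactly \<open>k\<close>, since the lister is called with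
      it; a smaller one would make \<open>M\<close> colorable with \<open>k\<close> colors.\<close>
    then have "k \<le> l"
      using False colorable_mono[of G M "Suc l" M k] by (metis Suc_leI not_le order_refl)
    ultimately have XS: "X S = enat k" by simp
    have "M - S \<in> set (L S k)"
    proof (rule maximal_listed[OF SV step.hyps(1) _ stab])
      fix J assume J: "J \<subseteq> pverts G - S" "stable G J"
      show "\<not> M - S \<subset> J"
      proof
        assume "M - S \<subset> J"
        then have "M \<subset> S \<union> J" using J by blast
        then show False
          using max[of "S \<union> J"] colorable_Un_stable[OF S_sub(3) J(2)] J(1) S_sub(1) step.prems(1)
          by blast
      qed
    next
      \<comment> \<open>The size bound of the small class \<open>I\<close> carries over to
        \<open>M - S\<close>; subtracting \<open>card (M - S)\<close> from both sides turns
        \<open>Suc k\<close> and \<open>M\<close> into \<open>k\<close> and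
        \<open>S\<close>.\<close>
      have "M - S \<subseteq> I" using S_sub by blast
      then have "card (M - S) \<le> card I"
        using I(1) fin by (meson card_mono finite_subset)
      then have "Suc k * card (M - S) \<le> card M"
        using I(4) by (meson mult_le_mono2 order_trans)
      moreover have "card M = card S + card (M - S)"
        using fin S_sub(1) by (metis card_Diff_subset card_mono finite_subset le_add_diff_inverse)
      ultimately show "k * card (M - S) \<le> card S" by simp
    qed (use step.prems(1) in blast)
    then have "X (S \<union> (M - S)) \<le> enat (Suc k)"
      using le_Suc[OF SV XS step.hyps(1)] by blast
    then show ?thesis using S_sub(1) by (simp add: Un_absorb1)
  qed
qed

text \<open>The whole vertex set has no proper superset among the vertices, so it is trivially
  maximal.\<close>

lemma full_entry: "X (pverts G) = enat (chi (pverts G))"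
proof (cases "chi (pverts G) \<le> 3")
  case True
  then show ?thesis using entry_eq_chi by blast
next
  case False
  then have "X (pverts G) \<le> enat (chi (pverts G))"
    by (intro maximal_colorable_entry) (auto simp: chi_le_iff[symmetric])
  then obtain k where "X (pverts G) = enat k" "k \<le> chi (pverts G)"
    by (cases "X (pverts G)") auto
  then show ?thesis
    using colorable_entry[of "pverts G" k] chi_le_iff[of "pverts G" k] by auto
qed

end


text \<open>The entry of \<open>S\<close> stays \<open>k\<close> during its own visit, so every
  write offers the same value \<open>Suc k\<close> and can only lower the cells of proper supersets
  of \<open>S\<close>.\<close>

lemma fold_update:
  assumes "X S = enat k"
  shows "fold (update S) xs X R \<le> X R"
    and "I \<in> set xs \<Longrightarrow> fold (update S) xs X (S \<union> I) \<le> enat (Suc k)"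
    and "fold (update S) xs X R = X R \<or>
      (\<exists>I\<in>set xs. R = S \<union> I \<and> S \<subset> R \<and> fold (update S) xs X R = enat (Suc k))"
proof -
  have "fold (update S) xs X R \<le> X R \<and>
    (\<forall>I\<in>set xs. fold (update S) xs X (S \<union> I) \<le> enat (Suc k)) \<and>
    (fold (update S) xs X R = X R \<or>
      (\<exists>I\<in>set xs. R = S \<union> I \<and> S \<subset> R \<and> fold (update S) xs X R = enat (Suc k)))" for R
  proof (induction xs arbitrary: R rule: rev_induct)
    case Nil
    show ?case by simp
  next
    case (snoc I xs)
    define Z where "Z = fold (update S) xs X"
    have Z_le: "Z R \<le> X R" for R
      using snoc.IH by (simp add: Z_def)
    have Z_listed: "Z (S \<union> J) \<le> enat (Suc k)" if "J \<in> set xs" for J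
      using snoc.IH that by (simp add: Z_def)
    have Z_cases: "Z R = X R \<or> (\<exists>I\<in>set xs. R = S \<union> I \<and> S \<subset> R \<and> Z R = enat (Suc k))" for R
      using snoc.IH unfolding Z_def by blast
    have ZS: "Z S = enat k" using Z_cases[of S] assms by auto
    have upd: "fold (update S) (xs @ [I]) X = Z(S \<union> I := min (Z (S \<union> I)) (enat (Suc k)))"
      by (simp add: Z_def[symmetric] update_def ZS eSuc_enat plus_1_eSuc(2))
    \<comment> \<open>A write that takes effect does not hit \<open>S\<close> itself, whose entry is
      already smaller.\<close>
    have "S \<subset> S \<union> I" if "enat (Suc k) < Z (S \<union> I)"
      using that ZS by (cases "S \<union> I = S") auto
    then show ?case
      unfolding upd using Z_le[of R] Z_listed Z_cases[of R]
      by (auto simp: min_def not_le dest: order_trans[of _ "Z _"])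
  qed
  then show "fold (update S) xs X R \<le> X R"
    and "I \<in> set xs \<Longrightarrow> fold (update S) xs X (S \<union> I) \<le> enat (Suc k)"
    and "fold (update S) xs X R = X R \<or>
      (\<exists>I\<in>set xs. R = S \<union> I \<and> S \<subset> R \<and> fold (update S) xs X R = enat (Suc k))"
    by blast+
qed

lemma visit_changes:
  shows "visit L S X R \<le> X R"
    and "visit L S X S = enat k \<Longrightarrow> 3 \<le> k \<Longrightarrow> I \<in> set (L S k) \<Longrightarrow>
      visit L S X (S \<union> I) \<le> enat (Suc k)"
    and "visit L S X R = X R \<or> (\<exists>k I. X S = enat k \<and> 3 \<le> k \<and> I \<in> set (L S k) \<and>
      R = S \<union> I \<and> S \<subset> R \<and> visit L S X R = enat (Suc k))"
proof -
  have three: "3 \<le> enat k \<longleftrightarrow> 3 \<le> k" for k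
    by (metis enat_ord_simps(1) numeral_eq_enat)
  have eq: "visit L S X = X \<or> (\<exists>k. X S = enat k \<and> 3 \<le> k \<and>
    visit L S X = fold (update S) (L S k) X)"
    by (cases "X S") (auto simp: visit_def three)
  then show "visit L S X R \<le> X R"
    using fold_update(1) by fastforce
  show changed: "visit L S X R = X R \<or> (\<exists>k I. X S = enat k \<and> 3 \<le> k \<and> I \<in> set (L S k) \<and>
      R = S \<union> I \<and> S \<subset> R \<and> visit L S X R = enat (Suc k))" for R
    using eq
  proof (elim disjE exE conjE)
    fix k assume "X S = enat k" "3 \<le> k" "visit L S X = fold (update S) (L S k) X"
    then show ?thesis using fold_update(3)[of X S k "L S k" R] by auto
  qed simp
  assume k: "visit L S X S = enat k" "3 \<le> k" "I \<in> set (L S k)"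
  then have "X S = enat k" using changed[of S] by auto
  moreover from this k have "visit L S X = fold (update S) (L S k) X"
    by (simp add: visit_def three)
  ultimately show "visit L S X (S \<union> I) \<le> enat (Suc k)"
    using fold_update(2) k by simp
qed

text \<open>A visit changes only proper supersets of the visited set, and these have larger codes.
  Hence an entry is final by the time its set is visited, and the loop invariant after
  \<open>m\<close> visits can speak of current entries.\<close>

lemma coloring_array_computed_array:
  assumes "pair_graph G" and V: "pverts G = {..<n}" and "valid_lister G L"
  shows "coloring_array G L (computed_array G n L)"
proof -
  interpret pair_graph G by fact
  define A where "A m = fold (visit L) (map set_decode [0..<m]) (initial_array G)" for m
  have A_Suc: "A (Suc m) = visit L (set_decode m) (A m)" for m
    by (simp add: A_def)
  have A: "(\<forall>S. A m S \<le> initial_array G S) \<and>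
    (\<forall>S k I. finite S \<longrightarrow> set_encode S < m \<longrightarrow> A m S = enat k \<longrightarrow> 3 \<le> k \<longrightarrow> I \<in> set (L S k) \<longrightarrow>
      A m (S \<union> I) \<le> enat (Suc k)) \<and>
    (\<forall>S. A m S = initial_array G S \<or> (\<exists>T I k. finite T \<and> set_encode T < m \<and> T \<subset> S \<and> S = T \<union> I \<and>
      A m T = enat k \<and> 3 \<le> k \<and> I \<in> set (L T k) \<and> A m S = enat (Suc k)))" for m
  proof (induction m)
    case 0
    show ?case by (simp add: A_def)
  next
    case (Suc m)
    let ?S = "set_decode m"
    note A1 = Suc.IH[THEN conjunct1, rule_format]
      and A2 = Suc.IH[THEN conjunct2, THEN conjunct1, rule_format]
      and A3 = Suc.IH[THEN conjunct2, THEN conjunct2, rule_format]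
    note v = visit_changes[of L ?S "A m", folded A_Suc]
    have keep: "A (Suc m) R = A m R" if "finite R" "set_encode R \<le> m" for R
      using v(3)[of R] that set_encode_psubset[of R ?S] by auto
    show ?case
    proof (intro conjI allI impI)
      fix S show "A (Suc m) S \<le> initial_array G S"
        using v(1) A1 by (rule order_trans)
    next
      fix S k I
      assume *: "finite S" "set_encode S < Suc m" "A (Suc m) S = enat k" "3 \<le> k" "I \<in> set (L S k)"
      show "A (Suc m) (S \<union> I) \<le> enat (Suc k)"
      proof (cases "set_encode S = m")
        case True
        then have "?S = S" using *(1) by auto
        then show ?thesis using v(2)[of k I] * by simp
      next
        case False
        then have "A m (S \<union> I) \<le> enat (Suc k)"
          using A2[of S k I] * keep[of S] by simp
        then show ?thesis using v(1) order_trans by blast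
      qed
    next
      fix S
      consider "A (Suc m) S = initial_array G S"
        | (old) T I k where "finite T" "set_encode T < m" "T \<subset> S" "S = T \<union> I" "A m T = enat k" "3 \<le> k"
          "I \<in> set (L T k)" "A (Suc m) S = enat (Suc k)"
        | (new) k I where "A m ?S = enat k" "3 \<le> k" "I \<in> set (L ?S k)" "S = ?S \<union> I" "?S \<subset> S"
          "A (Suc m) S = enat (Suc k)"
        using v(3)[of S] A3[of S] by metis
      then show "A (Suc m) S = initial_array G S \<or>
        (\<exists>T I k. finite T \<and> set_encode T < Suc m \<and> T \<subset> S \<and> S = T \<union> I \<and>
          A (Suc m) T = enat k \<and> 3 \<le> k \<and> I \<in> set (L T k) \<and> A (Suc m) S = enat (Suc k))"
      proof cases
        case old
        then show ?thesis using keep[of T] by (intro disjI2 exI[of _ T] exI[of _ I] exI[of _ k]) auto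
      next
        case new
        then show ?thesis using keep[of ?S] by (intro disjI2 exI[of _ ?S] exI[of _ I] exI[of _ k]) auto
      qed simp
    qed
  qed
  have C: "computed_array G n L = A (2 ^ n)"
    by (simp add: computed_array_def A_def)
  show ?thesis
  proof
    show "valid_lister G L" by fact
  next
    fix S assume "S \<subseteq> pverts G"
    then show "computed_array G n L S \<le> initial_array G S"
      using A C by simp
  next
    fix S k I
    assume S: "S \<subseteq> pverts G" "computed_array G n L S = enat k" "3 \<le> k" "I \<in> set (L S k)"
    then have "finite S" "set_encode S < 2 ^ n"
      using V finite_subset[OF _ pair_finite_verts] set_encode_less_power_iff[of S n] by simp_all
    then show "computed_array G n L (S \<union> I) \<le> enat (Suc k)"
      using A[of "2 ^ n"] S C by simp
  next
    fix S assume "S \<subseteq> pverts G"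
    show "computed_array G n L S = initial_array G S \<or>
      (\<exists>T I k. T \<subset> S \<and> S = T \<union> I \<and> computed_array G n L T = enat k \<and> 3 \<le> k \<and> I \<in> set (L T k) \<and>
        computed_array G n L S = enat (Suc k))"
      using A[of "2 ^ n"] unfolding C by blast
  qed
qed


section \<open>Runs of the machine\<close>

text \<open>A functional counterpart of the relational power in \<open>halts_in\<close>, which lets
  the simplifier execute short stretches of the program symbolically.\<close>

fun run :: "nat \<Rightarrow> instr list \<Rightarrow> nat \<Rightarrow> config \<Rightarrow> config option" where
  "run W P 0 C = Some C"
| "run W P (Suc t) C = Option.bind (step W P C) (run W P t)"

lemma run_numeral:
  "run W P (numeral k) C = Option.bind (step W P C) (run W P (pred_numeral k))"
  by (simp add: numeral_eq_Suc)

lemma run_add: "run W P t C = Some C' \<Longrightarrow> run W P u C' = Some C'' \<Longrightarrow> run W P (t + u) C = Some C''"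
  by (induction t arbitrary: C) (auto split: bind_splits)

lemma relpow_of_run: "run W P t C = Some C' \<Longrightarrow> ((\<lambda>c c'. step W P c = Some c') ^^ t) C C'"
  by (induction t arbitrary: C) (auto split: bind_splits simp del: relpowp.simps(2) intro: relpowp_Suc_I2)

declare run.simps(2) [simp del]

text \<open>Keeps register files in the normal form of an explicit list.\<close>

definition regs :: "nat list \<Rightarrow> nat \<Rightarrow> nat" where
  "regs xs i = (if i < length xs then xs ! i else 0)"

lemma regs_less [simp]: "i < length xs \<Longrightarrow> regs xs i = xs ! i"
  by (simp add: regs_def)

lemma regs_update [simp]: "i < length xs \<Longrightarrow> (regs xs)(i := x) = regs (xs[i := x])"
  by (auto simp: regs_def)


section \<open>The program\<close>

text \<open>
  Registers: 1, 2 and 3 hold the constants 1, 2 and 0; 4 holds \<open>2 ^ n\<close>; 5 and 6 hold the codes of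
  the current set \<open>S\<close> and of the current candidate \<open>T \<subset> S\<close>; 7 holds the lowest bit of \<open>T\<close>; 8 holds
  the entry of \<open>S\<close>, which also serves as the color of \<open>S - T\<close>; 9 is scratch; 10 and 11 hold
  the remaining bits of \<open>S - T\<close> and the output cell for the lowest of them.
\<close>

definition coloring_program :: "instr list" where
  "coloring_program =
    [LoadConst 1 1,
     LoadConst 2 2,
     LoadConst 4 1,
     JumpEq 0 3 7,
     Arith Mul 4 4 2,
     Arith Sub 0 0 1,
     JumpEq 3 3 3,
     Arith Sub 5 4 1,
     JumpEq 5 3 38, \<comment> \<open>8: start of a round\<close>
     Load 8 5,
     Arith Add 6 5 3,
     Arith Add 7 1 3, \<comment> \<open>11: next candidate\<close>
     Arith Div 9 6 7,
     Arith Mod 9 9 2,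
     JumpEq 9 1 17,
     Arith Mul 7 7 2,
     JumpEq 3 3 12,
     Arith Sub 6 6 7, \<comment> \<open>17: the lowest bit is found\<close>
     Arith Mod 9 5 7,
     Arith Add 6 6 9,
     Load 9 6,
     Arith Add 9 9 1,
     JumpEq 9 8 24,
     JumpEq 3 3 11,
     Arith Sub 10 5 6,
     Load 9 10,
     JumpEq 9 2 28,
     JumpEq 3 3 11,
     Arith Add 11 4 3, \<comment> \<open>28: coloring\<close>
     JumpEq 10 3 36,
     Arith Mod 9 10 2,
     JumpEq 9 3 33,
     Store 11 8,
     Arith Div 10 10 2,
     Arith Add 11 11 1,
     JumpEq 3 3 29,
     Arith Add 5 6 3,
     JumpEq 3 3 8,
     Halt]"

lemma length_coloring_program: "length coloring_program = 39"
  by (simp add: coloring_program_def)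

lemma coloring_program_nth:
  "coloring_program ! 0 = LoadConst 1 1"
  "coloring_program ! Suc 0 = LoadConst 2 2"
  "coloring_program ! Suc (Suc 0) = LoadConst 4 1"
  "coloring_program ! 3 = JumpEq 0 3 7"
  "coloring_program ! 4 = Arith Mul 4 4 2"
  "coloring_program ! 5 = Arith Sub 0 0 1"
  "coloring_program ! 6 = JumpEq 3 3 3"
  "coloring_program ! 7 = Arith Sub 5 4 1"
  "coloring_program ! 8 = JumpEq 5 3 38"
  "coloring_program ! 9 = Load 8 5"
  "coloring_program ! 10 = Arith Add 6 5 3"
  "coloring_program ! 11 = Arith Add 7 1 3"
  "coloring_program ! 12 = Arith Div 9 6 7"
  "coloring_program ! 13 = Arith Mod 9 9 2"
  "coloring_program ! 14 = JumpEq 9 1 17"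
  "coloring_program ! 15 = Arith Mul 7 7 2"
  "coloring_program ! 16 = JumpEq 3 3 12"
  "coloring_program ! 17 = Arith Sub 6 6 7"
  "coloring_program ! 18 = Arith Mod 9 5 7"
  "coloring_program ! 19 = Arith Add 6 6 9"
  "coloring_program ! 20 = Load 9 6"
  "coloring_program ! 21 = Arith Add 9 9 1"
  "coloring_program ! 22 = JumpEq 9 8 24"
  "coloring_program ! 23 = JumpEq 3 3 11"
  "coloring_program ! 24 = Arith Sub 10 5 6"
  "coloring_program ! 25 = Load 9 10"
  "coloring_program ! 26 = JumpEq 9 2 28"
  "coloring_program ! 27 = JumpEq 3 3 11"
  "coloring_program ! 28 = Arith Add 11 4 3"
  "coloring_program ! 29 = JumpEq 10 3 36"
  "coloring_program ! 30 = Arith Mod 9 10 2"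
  "coloring_program ! 31 = JumpEq 9 3 33"
  "coloring_program ! 32 = Store 11 8"
  "coloring_program ! 33 = Arith Div 10 10 2"
  "coloring_program ! 34 = Arith Add 11 11 1"
  "coloring_program ! 35 = JumpEq 3 3 29"
  "coloring_program ! 36 = Arith Add 5 6 3"
  "coloring_program ! 37 = JumpEq 3 3 8"
  "coloring_program ! 38 = Halt"
  by (simp_all add: coloring_program_def)

lemmas symbolic_step = run.simps(2) run_numeral step_def write_reg_def length_coloring_program coloring_program_nth

text \<open>Abstracts from the graph: \<open>a s\<close> is the content of cell \<open>s\<close>.
  Cells hold the entry plus one and 0 for \<infinity>, so 2 marks the nonempty independent sets and
  1 marks the empty set. The slack in \<open>a_less\<close> allows for the increment before the
  comparison with the entry of \<open>S\<close>.\<close>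

locale coloring_run =
  fixes n W :: nat and a :: "nat \<Rightarrow> nat"
  assumes W_def: "W = 2 ^ (n + 2)"
    and a_less: "Suc (a s) < W"
    and peel: "B \<subseteq> {..<n} \<Longrightarrow> 2 \<le> a (set_encode B) \<Longrightarrow>
      \<exists>C. C \<subset> B \<and> Suc (a (set_encode C)) = a (set_encode B) \<and> a (set_encode (B - C)) = 2"
    and not_1: "B \<subseteq> {..<n} \<Longrightarrow> B \<noteq> {} \<Longrightarrow> a (set_encode B) \<noteq> 1"
begin

section \<open>Execution of the program on an abstract array\<close>

abbreviation N :: nat where "N \<equiv> 2 ^ n"

abbreviation go :: "nat \<Rightarrow> config \<Rightarrow> config option" where
  "go \<equiv> run W coloring_program"

text \<open>The output cells are left free, so painting preserves this property.\<close>

definition represents :: "nat list \<Rightarrow> bool" where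
  "represents M \<longleftrightarrow> N + n \<le> length M \<and> (\<forall>s<N. M ! s = a s)"

lemma W_bounds: "4 \<le> W" "4 * N \<le> W" "n < N" "Suc 0 < W" "2 < W" "N < W"
proof -
  have "1 \<le> N" "W = 4 * N" by (auto simp: W_def)
  then show "4 \<le> W" "4 * N \<le> W" "Suc 0 < W" "2 < W" "N < W" by linarith+
qed simp

lemma go_power:
  "N = 2 ^ (i + j) \<Longrightarrow> go (4 * i + 1) (3, regs [i, 1, 2, 0, 2 ^ j, 0, 0, 0, 0, 0, 0, 0], M) =
    Some (7, regs [0, 1, 2, 0, N, 0, 0, 0, 0, 0, 0, 0], M)"
proof (induction i arbitrary: j)
  case 0
  then show ?case by (simp add: symbolic_step)
next
  case (Suc i)
  have "2 ^ j \<le> N"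
    unfolding Suc.prems by (intro power_increasing) auto
  then have "2 * 2 ^ j < W"
    using W_bounds by linarith
  moreover have "i < W"
    using Suc.prems W_bounds(2) less_exp[of "Suc i + j"] by linarith
  ultimately have "go 4 (3, regs [Suc i, 1, 2, 0, 2 ^ j, 0, 0, 0, 0, 0, 0, 0], M) =
      Some (3, regs [i, 1, 2, 0, 2 ^ Suc j, 0, 0, 0, 0, 0, 0, 0], M)"
    using Suc.prems W_bounds(1) by (simp add: symbolic_step mult.commute)
  from run_add[OF this Suc.IH[of "Suc j"]] Suc.prems show ?case
    by (simp add: add.commute)
qed

lemma go_init:
  "go (4 * n + 5) (0, (\<lambda>_. 0)(0 := n), M) =
    Some (8, regs [0, 1, 2, 0, N, N - 1, 0, 0, 0, 0, 0, 0], M)"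
proof -
  have "(\<lambda>_. 0)(0 := n) = regs [n, 0, 0, 0, 0, 0, 0, 0, 0, 0, 0, 0]"
    by (auto simp: regs_def fun_eq_iff nth_Cons')
  then have start: "go 3 (0, (\<lambda>_. 0)(0 := n), M) = Some (3, regs [n, 1, 2, 0, 2 ^ 0, 0, 0, 0, 0, 0, 0, 0], M)"
    using W_bounds(1) by (simp add: symbolic_step)
  have "go 1 (7, regs [0, 1, 2, 0, N, 0, 0, 0, 0, 0, 0, 0], M) =
      Some (8, regs [0, 1, 2, 0, N, N - 1, 0, 0, 0, 0, 0, 0], M)"
  proof -
    have "N - Suc 0 < W" using W_bounds by linarith
    then show ?thesis by (simp add: symbolic_step)
  qed
  from run_add[OF run_add[OF start go_power] this] show ?thesis
    by (simp add: add.commute)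
qed

text \<open>Five steps for each zero bit that is passed, three for the bit that is found.\<close>

lemma go_lowest_bit:
  assumes "set_encode A < N" "finite A" "A \<noteq> {}" "j \<le> Min A"
  shows "go (5 * (Min A - j) + 3) (12, regs [0, 1, 2, 0, N, S, set_encode A, 2 ^ j, k, x, D, c], M) =
    Some (17, regs [0, 1, 2, 0, N, S, set_encode A, 2 ^ Min A, k, 1, D, c], M)"
  using assms(4)
proof (induction "Min A - j" arbitrary: j x)
  case 0
  then have "odd (set_encode A div 2 ^ j)"
    using assms(2,3) Min_in[of A] by (simp add: odd_set_encode_div)
  moreover have "set_encode A div 2 ^ j < W"
    using assms(1) W_bounds div_le_dividend[of "set_encode A" "2 ^ j"] by linarith
  ultimately show ?case
    using 0 W_bounds by (simp add: symbolic_step odd_iff_mod_2_eq_one)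
next
  case (Suc i)
  then have "j \<notin> A" using Min_le[OF assms(2), of j] by auto
  then have even: "even (set_encode A div 2 ^ j)"
    using odd_set_encode_div[OF assms(2), of j] by blast
  have less: "set_encode A div 2 ^ j < W"
    using assms(1) W_bounds div_le_dividend[of "set_encode A" "2 ^ j"] by linarith
  have "Min A < n"
    using assms(1-3) Min_in[of A] set_encode_less_power_iff[of A n] by blast
  then have "2 ^ j < N" using Suc by simp
  then have "2 * 2 ^ j < W" using W_bounds by linarith
  then have "go 5 (12, regs [0, 1, 2, 0, N, S, set_encode A, 2 ^ j, k, x, D, c], M) =
      Some (12, regs [0, 1, 2, 0, N, S, set_encode A, 2 ^ Suc j, k, 0, D, c], M)"
    using even less W_bounds by (simp add: symbolic_step even_iff_mod_2_eq_zero mult.commute)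
  from run_add[OF this Suc.hyps(1)[of "Suc j" 0]] Suc show ?case
    by (simp add: algebra_simps Suc_diff_Suc)
qed

lemma go_next_subset:
  assumes "B \<subseteq> {..<n}" "A \<subseteq> B" "A \<noteq> {}"
  shows "go (5 * Min A + 7) (11, regs [0, 1, 2, 0, N, set_encode B, set_encode A, p, k, x, D, c], M) =
    Some (20, regs [0, 1, 2, 0, N, set_encode B, set_encode (next_subset B A), 2 ^ Min A, k,
      set_encode B mod 2 ^ Min A, D, c], M)"
proof -
  have fin: "finite B" "finite A"
    using finite_subset[OF assms(1)] finite_subset[OF assms(2)] by simp_all
  have enc: "set_encode A < N" "set_encode B < N"
    using assms fin by (auto simp: set_encode_less_power_iff)
  have "go 1 (11, regs [0, 1, 2, 0, N, set_encode B, set_encode A, p, k, x, D, c], M) =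
      Some (12, regs [0, 1, 2, 0, N, set_encode B, set_encode A, 2 ^ 0, k, x, D, c], M)"
    using W_bounds by (simp add: symbolic_step)
  from run_add[OF this go_lowest_bit[OF enc(1) fin(2) assms(3)]]
  have found: "go (5 * Min A + 4) (11, regs [0, 1, 2, 0, N, set_encode B, set_encode A, p, k, x, D, c], M) =
      Some (17, regs [0, 1, 2, 0, N, set_encode B, set_encode A, 2 ^ Min A, k, 1, D, c], M)"
    by (simp add: add.commute)
  have "go 3 (17, regs [0, 1, 2, 0, N, set_encode B, set_encode A, 2 ^ Min A, k, 1, D, c], M) =
    Some (20, regs [0, 1, 2, 0, N, set_encode B, set_encode (next_subset B A), 2 ^ Min A, k,
      set_encode B mod 2 ^ Min A, D, c], M)"
  proof -
    have "set_encode B mod 2 ^ Min A \<le> set_encode B" by (rule mod_less_eq_dividend)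
    then have "set_encode A - 2 ^ Min A + set_encode B mod 2 ^ Min A < W"
      using enc W_bounds(2) by linarith
    then show ?thesis
      using enc W_bounds by (simp add: symbolic_step set_encode_next_subset[OF fin(1) assms(2,3)])
  qed
  from run_add[OF found this] show ?thesis by (simp add: add.commute)
qed

text \<open>The witness \<open>C\<close> guarantees success: it stays below the current candidate
  until it is reached, so the search stops there at the latest, possibly at an earlier
  \<open>A'\<close>. The time is paid by the potential \<open>14 * halves\<close>.\<close>

lemma go_search:
  assumes B: "B \<subseteq> {..<n}" and M: "represents M" and k: "k = a (set_encode B)"
    and C: "C \<subset> B" "Suc (a (set_encode C)) = k" "a (set_encode (B - C)) = 2"
    and A: "A \<subseteq> B" "set_encode C < set_encode A"
  shows "\<exists>A' t p x. A' \<subset> B \<and> Suc (a (set_encode A')) = k \<and> a (set_encode (B - A')) = 2 \<and>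
    go t (11, regs [0, 1, 2, 0, N, set_encode B, set_encode A, p0, k, x0, D, c], M) =
      Some (28, regs [0, 1, 2, 0, N, set_encode B, set_encode A', p, k, x, set_encode (B - A'), c], M) \<and>
    t + 14 * halves (set_encode A') \<le> 14 * halves (set_encode A)"
  using A
proof (induction "set_encode A" arbitrary: A p0 x0 D rule: less_induct)
  case less
  have "A \<noteq> {}" using less.prems(2) by auto
  note A = less.prems(1) this
  have fin: "finite B" "finite A"
    using finite_subset[OF B] finite_subset[OF A(1)] by simp_all
  let ?A = "next_subset B A" and ?S = "set_encode B" and ?p = "2 ^ Min A"
  note nexts = next_subset_subset[OF fin(1) A] set_encode_next_subset_less[OF fin(1) A]
    set_encode_le_next_subset[OF fin(1) A psubset_imp_subset[OF C(1)] less.prems(2)]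
  have "?p dvd set_encode A"
    using fin(2) by (intro power_dvd_set_encode) auto
  then have "halves (set_encode A - 1) + Min A < halves (set_encode A)"
    using less.prems(2) by (intro halves_pred) auto
  moreover have "halves (set_encode ?A) \<le> halves (set_encode A - 1)"
    using nexts(2) by (intro order_trans[OF le_add1 halves_add_le]) simp
  \<comment> \<open>The longest pass takes \<open>5 * Min A + 7\<close> steps to form the candidate
    and 7 to reject it; the potential drops by at least \<open>14 * (Min A + 1)\<close>.\<close>
  ultimately have pot: "5 * Min A + 14 + 14 * halves (set_encode ?A) \<le> 14 * halves (set_encode A)"
    by linarith
  have A'B: "?A \<subset> B"
    using nexts(1,2) subset_decode_imp_le[of "set_encode A" ?S] A(1) fin
    by (simp add: psubset_eq) (metis not_le)
  have finC: "finite C" and finA': "finite ?A"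
    using finite_subset[OF psubset_imp_subset[OF C(1)] fin(1)] finite_subset[OF nexts(1) fin(1)] .
  have enc: "?S < N" "set_encode ?A < N" "set_encode (B - ?A) < N"
    using B nexts(1) fin(1) finA' by (auto simp: set_encode_less_power_iff)
  have cells: "M ! set_encode ?A = a (set_encode ?A)" "M ! set_encode (B - ?A) = a (set_encode (B - ?A))"
      "N \<le> length M"
    using M enc by (auto simp: represents_def)
  note diff = set_encode_Diff[OF fin(1) nexts(1), symmetric]
  note pre = go_next_subset[OF B A, of p0 k x0 D c M]
  consider (small) "Suc (a (set_encode ?A)) \<noteq> k"
    | (unstable) "Suc (a (set_encode ?A)) = k" "a (set_encode (B - ?A)) \<noteq> 2"
    | (found) "Suc (a (set_encode ?A)) = k" "a (set_encode (B - ?A)) = 2"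
    by blast
  then show ?case
  proof cases
    case found
    have "go 6 (20, regs [0, 1, 2, 0, N, ?S, set_encode ?A, ?p, k, ?S mod ?p, D, c], M) =
      Some (28, regs [0, 1, 2, 0, N, ?S, set_encode ?A, ?p, k, a (set_encode (B - ?A)),
        set_encode (B - ?A), c], M)"
      using found enc cells W_bounds a_less[of "set_encode ?A"] a_less[of "set_encode (B - ?A)"]
      by (simp add: symbolic_step diff)
    from run_add[OF pre this] show ?thesis
      using found A'B pot by (intro exI[of _ ?A] exI[of _ "5 * Min A + 7 + 6"] exI conjI) auto
  next
    case small
    then have "?A \<noteq> C" using C by auto
    then have lt: "set_encode C < set_encode ?A"
      using nexts(3) finC finA' by (simp add: set_encode_eq le_neq_implies_less)
    have "go 4 (20, regs [0, 1, 2, 0, N, ?S, set_encode ?A, ?p, k, ?S mod ?p, D, c], M) =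
      Some (11, regs [0, 1, 2, 0, N, ?S, set_encode ?A, ?p, k, Suc (a (set_encode ?A)), D, c], M)"
      using small enc cells W_bounds a_less[of "set_encode ?A"] by (simp add: symbolic_step)
    note pre' = run_add[OF pre this]
    from less.hyps[OF nexts(2) nexts(1) lt, of ?p "Suc (a (set_encode ?A))" D]
    obtain A' t p x where *: "A' \<subset> B" "Suc (a (set_encode A')) = k" "a (set_encode (B - A')) = 2"
      "go t (11, regs [0, 1, 2, 0, N, ?S, set_encode ?A, ?p, k, Suc (a (set_encode ?A)), D, c], M) =
        Some (28, regs [0, 1, 2, 0, N, ?S, set_encode A', p, k, x, set_encode (B - A'), c], M)"
      "t + 14 * halves (set_encode A') \<le> 14 * halves (set_encode ?A)"
      by blast
    show ?thesis
      by (rule exI[of _ A'], rule exI[of _ "5 * Min A + 7 + 4 + t"], rule exI[of _ p], rule exI[of _ x])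
        (use *(1-3,5) pot run_add[OF pre' *(4)] in auto)
  next
    case unstable
    then have "?A \<noteq> C" using C by auto
    then have lt: "set_encode C < set_encode ?A"
      using nexts(3) finC finA' by (simp add: set_encode_eq le_neq_implies_less)
    let ?D = "set_encode (B - ?A)"
    have "go 7 (20, regs [0, 1, 2, 0, N, ?S, set_encode ?A, ?p, k, ?S mod ?p, D, c], M) =
      Some (11, regs [0, 1, 2, 0, N, ?S, set_encode ?A, ?p, k, a ?D, ?D, c], M)"
      using unstable enc cells W_bounds a_less[of "set_encode ?A"] a_less[of ?D]
      by (simp add: symbolic_step diff)
    note pre' = run_add[OF pre this]
    from less.hyps[OF nexts(2) nexts(1) lt, of ?p "a ?D" ?D]
    obtain A' t p x where *: "A' \<subset> B" "Suc (a (set_encode A')) = k" "a (set_encode (B - A')) = 2"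
      "go t (11, regs [0, 1, 2, 0, N, ?S, set_encode ?A, ?p, k, a ?D, ?D, c], M) =
        Some (28, regs [0, 1, 2, 0, N, ?S, set_encode A', p, k, x, set_encode (B - A'), c], M)"
      "t + 14 * halves (set_encode A') \<le> 14 * halves (set_encode ?A)"
      by blast
    show ?thesis
      by (rule exI[of _ A'], rule exI[of _ "5 * Min A + 7 + 7 + t"], rule exI[of _ p], rule exI[of _ x])
        (use *(1-3,5) pot run_add[OF pre' *(4)] in auto)
  qed
qed

text \<open>Each bit costs at most 7 steps. The bound linear in the code \<open>D\<close> is crude
  but sufficient, because the codes of the disjoint color classes add up to that of the whole
  set.\<close>

lemma go_paint:
  assumes "D < W" "D < 2 ^ m" "c + m \<le> length M" "c + m < W"
  shows "\<exists>t x c' M'. go t (29, regs [0, 1, 2, 0, N, S, T, p, k, x0, D, c], M) =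
      Some (36, regs [0, 1, 2, 0, N, S, T, p, k, x, 0, c'], M') \<and> t \<le> 7 * D + 1 \<and>
    length M' = length M \<and>
    (\<forall>i<length M. M' ! i = (if c \<le> i \<and> i - c \<in> set_decode D then k else M ! i))"
  using assms
proof (induction D arbitrary: m c x0 M rule: less_induct)
  case (less D)
  show ?case
  proof (cases "D = 0")
    case True
    have "go 1 (29, regs [0, 1, 2, 0, N, S, T, p, k, x0, D, c], M) =
      Some (36, regs [0, 1, 2, 0, N, S, T, p, k, x0, 0, c], M)"
      using True by (simp add: symbolic_step)
    then show ?thesis
      using True by (intro exI[of _ 1] exI[of _ x0] exI[of _ c] exI[of _ M]) auto
  next
    case False
    then obtain m' where m: "m = Suc m'"
      using less.prems(2) by (cases m) auto
    define M1 where "M1 = (if odd D then M[c := k] else M)"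
    have "\<exists>t\<le>7. go t (29, regs [0, 1, 2, 0, N, S, T, p, k, x0, D, c], M) =
        Some (29, regs [0, 1, 2, 0, N, S, T, p, k, D mod 2, D div 2, Suc c], M1)"
    proof (cases "odd D")
      case True
      then show ?thesis
        using False less.prems m W_bounds
        by (intro exI[of _ 7]) (simp add: symbolic_step M1_def odd_iff_mod_2_eq_one)
    next
      case ev: False
      then show ?thesis
        using False less.prems m W_bounds
        by (intro exI[of _ 6]) (simp add: symbolic_step M1_def even_iff_mod_2_eq_zero)
    qed
    then obtain t1 where t1: "t1 \<le> 7" "go t1 (29, regs [0, 1, 2, 0, N, S, T, p, k, x0, D, c], M) =
        Some (29, regs [0, 1, 2, 0, N, S, T, p, k, D mod 2, D div 2, Suc c], M1)"
      by blast
    have "D div 2 < D" "D div 2 < W" "D div 2 < 2 ^ m'" "Suc c + m' \<le> length M1" "Suc c + m' < W"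
      using False less.prems m by (auto simp: M1_def)
    from less.IH[OF this, of "D mod 2"] obtain t x c' M' where
      t: "go t (29, regs [0, 1, 2, 0, N, S, T, p, k, D mod 2, D div 2, Suc c], M1) =
        Some (36, regs [0, 1, 2, 0, N, S, T, p, k, x, 0, c'], M')" "t \<le> 7 * (D div 2) + 1"
      and M': "length M' = length M1" "\<forall>i<length M1. M' ! i =
        (if Suc c \<le> i \<and> i - Suc c \<in> set_decode (D div 2) then k else M1 ! i)"
      by blast
    have len: "length M1 = length M" by (simp add: M1_def)
    have "M' ! i = (if c \<le> i \<and> i - c \<in> set_decode D then k else M ! i)" if "i < length M" for i
    proof -
      consider "i < c" | "i = c" | j where "i = Suc c + j"
        using less_iff_Suc_add by (metis add_Suc nat_neq_iff)
      then show ?thesis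
        using that M' len
        by cases (auto simp: M1_def Suc_diff_le)
    qed
    moreover have "t1 + t \<le> 7 * D + 1"
      using t1(1) t(2) \<open>D div 2 < D\<close> by linarith
    ultimately show ?thesis
      using run_add[OF t1(2) t(1)] M'(1) len
      by (intro exI[of _ "t1 + t"] exI[of _ x] exI[of _ c'] exI[of _ M']) auto
  qed
qed

text \<open>The remainder only gets colors up to its own cell value, one less than that of
  \<open>B\<close>, so the new class has a color of its own. Of the potential
  \<open>28 * halves\<close>, half pays for the search and half for painting and overhead.\<close>

lemma go_rounds:
  assumes "B \<subseteq> {..<n}" "B = {} \<or> 2 \<le> a (set_encode B)" "represents M"
  shows "\<exists>t R M'. go t (8, regs [0, 1, 2, 0, N, set_encode B, T, p, k, x, D, c], M) = Some (38, R, M') \<and>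
    t \<le> 28 * halves (set_encode B) + 1 \<and>
    (\<forall>v<n. v \<notin> B \<longrightarrow> M' ! (N + v) = M ! (N + v)) \<and>
    (\<forall>v\<in>B. 2 \<le> M' ! (N + v) \<and> M' ! (N + v) \<le> a (set_encode B)) \<and>
    (\<forall>u\<in>B. \<forall>v\<in>B. M' ! (N + u) = M' ! (N + v) \<longrightarrow>
      (\<exists>I\<subseteq>{..<n}. a (set_encode I) = 2 \<and> u \<in> I \<and> v \<in> I))"
  using assms
proof (induction "set_encode B" arbitrary: B M T p k x D c rule: less_induct)
  case less
  note B = less.prems(1) and M = less.prems(3)
  have fin: "finite B" using finite_subset[OF B] by simp
  let ?S = "set_encode B"
  show ?case
  proof (cases "B = {}")
    case True
    have "go 1 (8, regs [0, 1, 2, 0, N, ?S, T, p, k, x, D, c], M) =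
      Some (38, regs [0, 1, 2, 0, N, ?S, T, p, k, x, D, c], M)"
      using True by (simp add: symbolic_step)
    then show ?thesis
      using True by (intro exI[of _ 1] exI[of _ M] exI conjI) auto
  next
    case False
    let ?k = "a ?S"
    have k: "2 \<le> ?k" using less.prems(2) False by blast
    obtain C where C: "C \<subset> B" "Suc (a (set_encode C)) = ?k" "a (set_encode (B - C)) = 2"
      using peel[OF B k] by blast
    have S: "?S < N" "?S \<noteq> 0"
      using B fin False set_encode_eq[OF fin, of "{}"] by (auto simp: set_encode_less_power_iff)
    have start: "go 3 (8, regs [0, 1, 2, 0, N, ?S, T, p, k, x, D, c], M) =
      Some (11, regs [0, 1, 2, 0, N, ?S, ?S, p, ?k, x, D, c], M)"
    proof -
      have "M ! ?S = ?k" "N \<le> length M"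
        using M S(1) by (auto simp: represents_def)
      then show ?thesis
        using S W_bounds a_less[of ?S] by (simp add: symbolic_step)
    qed
    obtain A t1 p1 x1 where A: "A \<subset> B" "Suc (a (set_encode A)) = ?k"
        "a (set_encode (B - A)) = 2"
      and t1: "go t1 (11, regs [0, 1, 2, 0, N, ?S, ?S, p, ?k, x, D, c], M) =
        Some (28, regs [0, 1, 2, 0, N, ?S, set_encode A, p1, ?k, x1, set_encode (B - A), c], M)"
      and t1_le: "t1 + 14 * halves (set_encode A) \<le> 14 * halves ?S"
      using go_search[OF B M refl C order_refl set_encode_psubset[OF fin C(1)], of p x D c] by blast
    note r1 = run_add[OF start t1]
    let ?T = "set_encode A" and ?D = "set_encode (B - A)"
    have A_less: "?T < ?S" by (rule set_encode_psubset[OF fin A(1)])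
    have D: "?D = ?S - ?T" "?D < N"
      using set_encode_Diff[OF fin psubset_imp_subset[OF A(1)]] S(1) by simp_all
    have "go 1 (28, regs [0, 1, 2, 0, N, ?S, ?T, p1, ?k, x1, ?D, c], M) =
        Some (29, regs [0, 1, 2, 0, N, ?S, ?T, p1, ?k, x1, ?D, N], M)"
      using W_bounds by (simp add: symbolic_step)
    note r2 = run_add[OF r1 this]
    have "?D < W" "N + n < W" "N + n \<le> length M"
      using D(2) W_bounds(2,3) M unfolding represents_def by linarith+
    from go_paint[OF this(1) D(2) this(3,2), of ?S ?T p1 ?k x1]
    obtain t2 x2 c2 M2 where
      t2: "go t2 (29, regs [0, 1, 2, 0, N, ?S, ?T, p1, ?k, x1, ?D, N], M) =
        Some (36, regs [0, 1, 2, 0, N, ?S, ?T, p1, ?k, x2, 0, c2], M2)" "t2 \<le> 7 * ?D + 1"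
      and M2: "length M2 = length M"
        "\<And>i. i < length M \<Longrightarrow> M2 ! i = (if N \<le> i \<and> i - N \<in> B - A then ?k else M ! i)"
      using fin by auto
    have "go 2 (36, regs [0, 1, 2, 0, N, ?S, ?T, p1, ?k, x2, 0, c2], M2) =
        Some (8, regs [0, 1, 2, 0, N, ?T, ?T, p1, ?k, x2, 0, c2], M2)"
      using W_bounds A_less S(1) by (simp add: symbolic_step)
    note r3 = run_add[OF run_add[OF r2 t2(1)] this]
    have AV: "A \<subseteq> {..<n}" using A(1) B by blast
    have "a ?T \<noteq> 1" if "A \<noteq> {}" using not_1[OF AV that] .
    \<comment> \<open>The cell of \<open>A\<close> is at least 1, and \<open>not_1\<close> excludes
      1 unless \<open>A\<close> is empty.\<close>
    then have A_ok: "A = {} \<or> 2 \<le> a ?T" using A(2) k by linarith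
    have M2_rep: "represents M2"
      using M M2 by (auto simp: represents_def)
    from less.hyps[OF A_less AV A_ok M2_rep, of ?T p1 ?k x2 0 c2]
    obtain t3 R M3 where
      t3: "go t3 (8, regs [0, 1, 2, 0, N, ?T, ?T, p1, ?k, x2, 0, c2], M2) = Some (38, R, M3)"
        "t3 \<le> 28 * halves ?T + 1"
      and M3: "\<And>v. v < n \<Longrightarrow> v \<notin> A \<Longrightarrow> M3 ! (N + v) = M2 ! (N + v)"
        "\<And>v. v \<in> A \<Longrightarrow> 2 \<le> M3 ! (N + v) \<and> M3 ! (N + v) \<le> a ?T"
        "\<And>u v. u \<in> A \<Longrightarrow> v \<in> A \<Longrightarrow> M3 ! (N + u) = M3 ! (N + v) \<Longrightarrow>
          \<exists>I\<subseteq>{..<n}. a (set_encode I) = 2 \<and> u \<in> I \<and> v \<in> I"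
      by blast
    have old: "M3 ! (N + v) = M ! (N + v)" if "v < n" "v \<notin> B" for v
      using M3(1)[of v] M2(2)[of "N + v"] that A(1) M by (auto simp: represents_def)
    have new: "M3 ! (N + v) = ?k" if "v \<in> B - A" for v
      using M3(1)[of v] M2(2)[of "N + v"] that B M by (auto simp: represents_def)
    have range: "2 \<le> M3 ! (N + v) \<and> M3 ! (N + v) \<le> ?k" if "v \<in> B" for v
      using new[of v] M3(2)[of v] that A(2) k by fastforce
    have classes: "\<exists>I\<subseteq>{..<n}. a (set_encode I) = 2 \<and> u \<in> I \<and> v \<in> I"
      if uv: "u \<in> B" "v \<in> B" "M3 ! (N + u) = M3 ! (N + v)" for u v
    proof (cases "u \<in> A")
      case True
      \<comment> \<open>Outside \<open>A\<close> the color of \<open>v\<close> would be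
        \<open>?k\<close>, above every color on \<open>A\<close>.\<close>
      then have "v \<in> A"
        using new[of v] M3(2)[of u] uv A(2) by fastforce
      then show ?thesis using M3(3)[OF True _ uv(3)] by blast
    next
      case False
      then have "v \<notin> A"
        using new[of u] M3(2)[of v] uv A(2) by fastforce
      then show ?thesis
        using False uv A(3) B by (intro exI[of _ "B - A"]) auto
    qed
    \<comment> \<open>The drop in \<open>halves\<close> is at least \<open>?D\<close>, so
      \<open>14 * ?D\<close> units are left after the search; as \<open>?D\<close> is positive, they
      cover \<open>7 * ?D\<close> for painting and 7 for the overhead.\<close>
    have "halves ?T + ?D \<le> halves ?S" "1 \<le> ?D"
      using halves_add_le[of ?T ?S] A_less D(1) by auto
    then have "3 + t1 + 1 + t2 + 2 + t3 \<le> 28 * halves ?S + 1"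
      using t1_le t2(2) t3(2) by linarith
    then show ?thesis
      using run_add[OF r3 t3(1)] old range classes
      by (intro exI[of _ "3 + t1 + 1 + t2 + 2 + t3"] exI[of _ R] exI[of _ M3]) blast
  qed
qed

end


section \<open>Optimality of the coloring\<close>

context coloring_array
begin

text \<open>The default 0 beyond the array makes the word bound hold at every index.\<close>

definition entry_code :: "nat \<Rightarrow> nat \<Rightarrow> nat" where
  "entry_code n s = (if s < 2 ^ n then encode_entry (X (set_decode s)) else 0)"

lemma entry_code_set_encode:
  "B \<subseteq> {..<n} \<Longrightarrow> entry_code n (set_encode B) = encode_entry (X B)"
  using finite_subset[of B "{..<n}"] by (simp add: entry_code_def set_encode_less_power_iff)

lemma coloring_run_entry_code:
  assumes V: "pverts G = {..<n}"
  shows "coloring_run n (2 ^ (n + 2)) (entry_code n)"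
proof
  fix s
  have "Suc (entry_code n s) \<le> n + 2"
  proof (cases "s < 2 ^ n")
    case True
    then have S: "set_decode s \<subseteq> {..<n}"
      using set_encode_less_power_iff[of "set_decode s" n] by simp
    then have "card (set_decode s) \<le> n"
      using card_mono[of "{..<n}" "set_decode s"] by simp
    then have "k \<le> n" if "X (set_decode s) = enat k" for k
      using entry_le_card[OF _ that] S V by simp
    then show ?thesis
      using True by (simp add: entry_code_def encode_entry_def split: enat.split)
  qed (simp add: entry_code_def)
  also have "n + 2 < 2 ^ (n + 2)" by (rule less_exp)
  finally show "Suc (entry_code n s) < 2 ^ (n + 2)" .
next
  fix B assume B: "B \<subseteq> {..<n}" and two: "2 \<le> entry_code n (set_encode B)"
  obtain j where j: "X B = enat j" "1 \<le> j"
    using B two by (auto simp: entry_code_set_encode encode_entry_def split: enat.splits)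
  then obtain k where k: "X B = enat (Suc k)"
    by (cases j) auto
  from B V have "B \<subseteq> pverts G" by simp
  from peel_class[OF this k]
  obtain T where T: "T \<subset> B" "X T = enat k" "X (B - T) = enat 1" .
  have "T \<subseteq> {..<n}" "B - T \<subseteq> {..<n}" using T(1) B by auto
  then show "\<exists>C. C \<subset> B \<and> Suc (entry_code n (set_encode C)) = entry_code n (set_encode B) \<and>
      entry_code n (set_encode (B - C)) = 2"
    using T k B by (intro exI[of _ T]) (simp add: entry_code_set_encode encode_entry_def)
next
  fix B assume B: "B \<subseteq> {..<n}" "B \<noteq> {}"
  then have "X B \<noteq> enat 0" using entry_0_iff V by simp
  then show "entry_code n (set_encode B) \<noteq> 1"
    using B by (auto simp: entry_code_set_encode encode_entry_def zero_enat_def split: enat.splits)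
qed simp

lemma program_colors_optimally:
  assumes V: "pverts G = {..<n}"
  shows "\<exists>t C. t \<le> 66 * 2 ^ n \<and>
    halts_in (2 ^ (n + 2)) coloring_program (input_config G n X) t C \<and>
    optimal_coloring (with_proj G) (output_coloring n C)"
proof -
  interpret coloring_run n "2 ^ (n + 2)" "entry_code n"
    using V by (rule coloring_run_entry_code)
  let ?B = "{..<n}" and ?M = "input_memory G n X"
  have full: "entry_code n (set_encode ?B) = Suc (chi ?B)"
    using full_entry V by (simp add: entry_code_set_encode encode_entry_def)
  have ok: "?B = {} \<or> 2 \<le> entry_code n (set_encode ?B)"
    using entry_0_iff[of ?B] full_entry V unfolding full by (cases "chi ?B") auto
  have rep: "represents ?M"
    by (simp add: represents_def input_memory_def entry_code_def nth_append)
  obtain t R M where t: "go t (8, regs [0, 1, 2, 0, N, set_encode ?B, 0, 0, 0, 0, 0, 0], ?M) = Some (38, R, M)"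
      "t \<le> 28 * halves (set_encode ?B) + 1"
    and range: "\<And>v. v < n \<Longrightarrow> 2 \<le> M ! (N + v) \<and> M ! (N + v) \<le> Suc (chi ?B)"
    and classes: "\<And>u v. u < n \<Longrightarrow> v < n \<Longrightarrow> M ! (N + u) = M ! (N + v) \<Longrightarrow>
      \<exists>I\<subseteq>?B. entry_code n (set_encode I) = 2 \<and> u \<in> I \<and> v \<in> I"
    using go_rounds[OF order_refl ok rep, of 0 0 0 0 0 0] unfolding full lessThan_iff Ball_def by blast
  have run: "go (4 * n + 5 + t) (input_config G n X) = Some (38, R, M)"
    using run_add[OF go_init[of ?M]] t(1) by (simp add: input_config_def set_encode_lessThan)
  have "t \<le> 56 * N + 1"
    using t(2) halves_le[of "set_encode ?B"] set_encode_lessThan[of n] by simp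
  moreover have "n < N" "1 \<le> N" by simp_all
  \<comment> \<open>66 = 4 + 6 + 56, from \<open>4 * n\<close>, the constants 5 + 1, and twice 28 by
    \<open>halves_le\<close>.\<close>
  ultimately have time: "4 * n + 5 + t \<le> 66 * N" by linarith
  let ?C = "(38, R, M)"
  have "halts_in (2 ^ (n + 2)) coloring_program (input_config G n X) (4 * n + 5 + t) ?C"
    using relpow_of_run[OF run] by (simp add: halts_in_def length_coloring_program coloring_program_nth)
  moreover have "optimal_coloring (with_proj G) (output_coloring n ?C)"
    unfolding optimal_coloring_def
  proof
    let ?f = "output_coloring n ?C"
    have f: "?f = (\<lambda>v. M ! (N + v))" by (simp add: output_coloring_def fun_eq_iff)
    show proper: "proper_coloring (with_proj G) ?f"
      unfolding proper_coloring_def f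
    proof (intro allI impI notI)
      fix u v assume uv: "u \<rightarrow>\<^bsub>with_proj G\<^esub> v" and eq: "M ! (N + u) = M ! (N + v)"
      then have "u < n" "v < n" using in_arcsD1 in_arcsD2 V by auto
      from classes[OF this eq] obtain I where
        I: "I \<subseteq> ?B" "entry_code n (set_encode I) = 2" "u \<in> I" "v \<in> I" by blast
      then have "X I = enat 1"
        by (auto simp: entry_code_set_encode encode_entry_def split: enat.splits)
      then show False
        using entry_1_iff[of I] I V uv by (auto simp: stable_def)
    qed
    \<comment> \<open>Colors are cell values and start at 2, so this palette has exactly
      \<open>chi ?B\<close> elements.\<close>
    have "card (?f ` ?B) \<le> card {2..Suc (chi ?B)}"
      using range by (intro card_mono) (auto simp: f)
    then show "card (?f ` verts (with_proj G)) = chromatic_number (with_proj G)"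
      using chromatic_number_le_card_colors[OF proper] chromatic_number_eq_chi V by simp
  qed
  ultimately show ?thesis using time by blast
qed

end

theorem theorem7:
  shows "\<exists>(P :: instr list) (c :: nat) (T :: nat \<Rightarrow> nat).
    (\<lambda>n. real (T n)) \<in> O(\<lambda>n. 2 ^ n) \<and>
    (\<forall>(n :: nat) (G :: nat pair_pre_digraph) (L :: nat set \<Rightarrow> nat \<Rightarrow> nat set list).
      pair_graph G \<and> pverts G = {..<n} \<and> valid_lister G L \<longrightarrow>
      (\<exists>t C. t \<le> T n \<and>
        halts_in (2 ^ (n + c)) P (input_config G n (computed_array G n L)) t C \<and>
        optimal_coloring (with_proj G) (output_coloring n C)))"
proof (rule exI[of _ coloring_program], rule exI[of _ 2], rule exI[of _ "\<lambda>n. 66 * 2 ^ n"],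
    intro conjI allI impI)
  show "(\<lambda>n. real (66 * 2 ^ n)) \<in> O(\<lambda>n. 2 ^ n)" by simp
next
  fix n :: nat and G :: "nat pair_pre_digraph" and L :: "nat set \<Rightarrow> nat \<Rightarrow> nat set list"
  assume G: "pair_graph G \<and> pverts G = {..<n} \<and> valid_lister G L"
  then interpret coloring_array G L "computed_array G n L"
    by (intro coloring_array_computed_array) auto
  show "\<exists>t C. t \<le> 66 * 2 ^ n \<and>
      halts_in (2 ^ (n + 2)) coloring_program (input_config G n (computed_array G n L)) t C \<and>
      optimal_coloring (with_proj G) (output_coloring n C)"
    using program_colors_optimally G by blast
qed

end
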